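(* Let $W$ be a dihedral group of order $2m$, $m\geq2$, with distinguished generators $S=\{s_1,s_2\}$. For $a\neq b$ in $S$ and $0<j\leq m$ let $\langle j,a,b]=\ldots ab$ denote the alternating product of $j$ factors $a,b$ whose last factor is $b$, let $(c_w)_{w\in W}$ be the Kazhdan-Lusztig basis of the Hecke algebra of $W$, and write $C_j=c_{\langle j,s_1,s_2]}$ for $0<j\leq m$. Let $0<k\leq m$, let $s$ be the first factor of the word $\langle k,s_1,s_2]$ (i.e. $s=s_1$ if $k$ is even, $s=s_2$ if $k$ is odd), and let $t$ be the other element of $S$. For $0<i\leq m$ consider the following formal $A$-linear combinations of symbols $C_j$, $j\geq1$ (indices increasing in steps of $2$): $$F_{i,k}=\begin{cases}C_{k-i}+2C_{k-i+2}+\cdots+2C_{k+i-2}+C_{k+i}&(0<i<k)\\ 2C_2+2C_4+\cdots+2C_{2k-2}+C_{2k}&(i=k)\\ C_{i-k}+2C_{i-k+2}+\cdots+2C_{i+k-2}+C_{i+k}&(i>k)\end{cases}$$ (for $i=k=1$, $F_{1,1}=C_2$), and $$G_{i,k}=\begin{cases}(v+v^{-1})C_{k-i+1}+(v+v^{-1})C_{k-i+3}+\cdots+(v+v^{-1})C_{k+i-1}&(0<i\leq k)\\ (v+v^{-1})C_{i-k+1}+(v+v^{-1})C_{i-k+3}+\cdots+(v+v^{-1})C_{i+k-1}&(i\geq k).\end{cases}$$ Then, for all $0<i\leq m$, the product $c_{\langle i,s,t]}\cdot C_k$ is given by $F_{i,k}$ and the product $c_{\langle i,t,s]}\cdot C_k$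 is given by $G_{i,k}$, except that any expression of the form $$C_{m+d}+C_{m-d},\qquad d>0,$$ that can be taken out of the formula should be replaced by $(v^d+v^{-d})\,C_m$ (where a term $C_0$ is understood to be $0$). Similar formulas hold with the roles of $s_1$ and $s_2$ exchanged, i.e. with $c_{\langle j,s_1,s_2]}$ replaced by $c_{\langle j,s_2,s_1]}$ throughout and $s$ the first factor of $\langle k,s_2,s_1]$.
   Context: For a Coxeter group $(W,S)$ with Bruhat order $\leq$, let $A=\mathbf{Z}[v,v^{-1}]$ with $v$ an indeterminate. The Hecke algebra $\mathcal{H}$ is the free $A$-module with basis $(t_y)_{y\in W}$, with the unique associative $A$-algebra structure such that, for $s\in S$ and $y\in W$, $$t_s t_y=\begin{cases}t_{sy}&\text{if } sy>y,\\ (v-v^{-1})t_y+t_{sy}&\text{if } sy<y.\end{cases}$$ There is a unique ring involution $\iota$ of $\mathcal{H}$ with $\iota(v)=v^{-1}$ and $\iota(t_y)=t_{y^{-1}}^{-1}$ for all $y\in W$. The Kazhdan-Lusztig basis of $\mathcal{H}$ is the unique family $(c_y)_{y\in W}$ such that $\iota(c_y)=c_y$ and $c_y=t_y+\sum_{x<y}p_{x,y}t_x$ with $p_{x,y}\in v^{-1}\mathbf{Z}[v^{-1}]$. In the dihedral group of order $2m$, $\langle m,s_1,s_2]=\langle m,s_2,s_1]$ is the longest element; symbols $C_j$ with $j>m$ are only formal (they are the terms occurring in the corresponding product formulas for the infinite dihedral group). *)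

theory Defs
  imports "HOL-Algebra.Algebra" "HOL-Library.Poly_Mapping"
begin

section \<open>Dihedral groups, length and Bruhat order\<close>

definition dihedral_group :: "('a, 'e) monoid_scheme \<Rightarrow> 'a \<Rightarrow> 'a \<Rightarrow> nat \<Rightarrow> bool" where
  "dihedral_group W s1 s2 m \<longleftrightarrow>
     group W \<and> s1 \<in> carrier W \<and> s2 \<in> carrier W \<and> s1 \<noteq> s2 \<and>
     s1 \<noteq> \<one>\<^bsub>W\<^esub> \<and> s2 \<noteq> \<one>\<^bsub>W\<^esub> \<and>
     s1 \<otimes>\<^bsub>W\<^esub> s1 = \<one>\<^bsub>W\<^esub> \<and> s2 \<otimes>\<^bsub>W\<^esub> s2 = \<one>\<^bsub>W\<^esub> \<and>
     generate W {s1, s2} = carrier W \<and> order W = 2 * m"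

definition word_product :: "('a, 'e) monoid_scheme \<Rightarrow> 'a list \<Rightarrow> 'a" where
  "word_product W ws = foldr (\<lambda>x y. x \<otimes>\<^bsub>W\<^esub> y) ws \<one>\<^bsub>W\<^esub>"

definition cox_length :: "('a, 'e) monoid_scheme \<Rightarrow> 'a set \<Rightarrow> 'a \<Rightarrow> nat" where
  "cox_length W S w = (LEAST n. \<exists>ws. set ws \<subseteq> S \<and> length ws = n \<and> word_product W ws = w)"

definition reflections :: "('a, 'e) monoid_scheme \<Rightarrow> 'a set \<Rightarrow> 'a set" where
  "reflections W S = {w \<otimes>\<^bsub>W\<^esub> s \<otimes>\<^bsub>W\<^esub> inv\<^bsub>W\<^esub> w | w s. w \<in> carrier W \<and> s \<in> S}"

definition bruhat_less :: "('a, 'e) monoid_scheme \<Rightarrow> 'a set \<Rightarrow> 'a \<Rightarrow> 'a \<Rightarrow> bool" where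
  "bruhat_less W S =
     (\<lambda>x y. x \<in> carrier W \<and> (\<exists>r\<in>reflections W S. y = x \<otimes>\<^bsub>W\<^esub> r) \<and>
            cox_length W S x < cox_length W S y)\<^sup>+\<^sup>+"

section \<open>The Hecke algebra and its Kazhdan-Lusztig basis\<close>

text \<open>
  The ring \<open>A = Z[v, v\<^sup>-\<^sup>1]\<close> is the group ring of the integers: finitely supported functions
  \<open>int \<Rightarrow>\<^sub>0 int\<close> with the convolution product, the key being the exponent of \<open>v\<close>.
\<close>

type_synonym laurent = "int \<Rightarrow>\<^sub>0 int"

definition vpow :: "int \<Rightarrow> laurent" where
  "vpow n = Poly_Mapping.single n 1"

text \<open>The subset \<open>v\<^sup>-\<^sup>1 Z[v\<^sup>-\<^sup>1]\<close> of \<open>A\<close>.\<close>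

definition neg_laurent :: "laurent set" where
  "neg_laurent = {p. Poly_Mapping.keys p \<subseteq> {..<0}}"

definition scal :: "laurent \<Rightarrow> ('b \<Rightarrow>\<^sub>0 laurent) \<Rightarrow> ('b \<Rightarrow>\<^sub>0 laurent)" (infixr "*\<^sub>A" 75) where
  "a *\<^sub>A f = Poly_Mapping.map (\<lambda>x. a * x) f"

type_synonym 'a hecke = "'a \<Rightarrow>\<^sub>0 laurent"

definition tbasis :: "'a \<Rightarrow> 'a hecke" where
  "tbasis y = Poly_Mapping.single y 1"

text \<open>
  The module underlying \<open>H\<close> is the concrete free \<open>A\<close>-module on \<open>carrier W\<close>; its multiplication
  is pinned down by the axioms.
\<close>

locale hecke_algebra = W: group W + H: ring H
  for W :: "('a, 'e) monoid_scheme" and S :: "'a set" and H :: "('a hecke) ring" +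
  assumes carrier_H: "carrier H = {f. Poly_Mapping.keys f \<subseteq> carrier W}"
    and add_H: "\<lbrakk>f \<in> carrier H; g \<in> carrier H\<rbrakk> \<Longrightarrow> f \<oplus>\<^bsub>H\<^esub> g = f + g"
    and scal_left: "\<lbrakk>f \<in> carrier H; g \<in> carrier H\<rbrakk> \<Longrightarrow> (a *\<^sub>A f) \<otimes>\<^bsub>H\<^esub> g = a *\<^sub>A (f \<otimes>\<^bsub>H\<^esub> g)"
    and scal_right: "\<lbrakk>f \<in> carrier H; g \<in> carrier H\<rbrakk> \<Longrightarrow> f \<otimes>\<^bsub>H\<^esub> (a *\<^sub>A g) = a *\<^sub>A (f \<otimes>\<^bsub>H\<^esub> g)"
    and t_mult_up: "\<lbrakk>s \<in> S; y \<in> carrier W; bruhat_less W S y (s \<otimes>\<^bsub>W\<^esub> y)\<rbrakk>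
      \<Longrightarrow> tbasis s \<otimes>\<^bsub>H\<^esub> tbasis y = tbasis (s \<otimes>\<^bsub>W\<^esub> y)"
    and t_mult_down: "\<lbrakk>s \<in> S; y \<in> carrier W; bruhat_less W S (s \<otimes>\<^bsub>W\<^esub> y) y\<rbrakk>
      \<Longrightarrow> tbasis s \<otimes>\<^bsub>H\<^esub> tbasis y = (vpow 1 - vpow (-1)) *\<^sub>A tbasis y + tbasis (s \<otimes>\<^bsub>W\<^esub> y)"

definition hecke_involution ::
    "('a, 'e) monoid_scheme \<Rightarrow> ('a hecke) ring \<Rightarrow> ('a hecke \<Rightarrow> 'a hecke) \<Rightarrow> bool" where
  "hecke_involution W H \<iota> \<longleftrightarrow>
     \<iota> \<in> ring_hom H H \<and> (\<forall>f\<in>carrier H. \<iota> (\<iota> f) = f) \<and>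
     \<iota> (vpow 1 *\<^sub>A \<one>\<^bsub>H\<^esub>) = vpow (-1) *\<^sub>A \<one>\<^bsub>H\<^esub> \<and>
     (\<forall>y\<in>carrier W. \<iota> (tbasis y) = inv\<^bsub>H\<^esub> (tbasis (inv\<^bsub>W\<^esub> y)))"

definition kl_basis ::
    "('a, 'e) monoid_scheme \<Rightarrow> 'a set \<Rightarrow> ('a hecke \<Rightarrow> 'a hecke) \<Rightarrow> ('a \<Rightarrow> 'a hecke) \<Rightarrow> bool" where
  "kl_basis W S \<iota> c \<longleftrightarrow>
     (\<forall>y\<in>carrier W. \<iota> (c y) = c y \<and>
        (\<exists>p. (\<forall>x. p x \<in> neg_laurent) \<and>
             c y = tbasis y + (\<Sum>x | bruhat_less W S x y. p x *\<^sub>A tbasis x)))"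

section \<open>Alternating words and the product formulas\<close>

text \<open>\<open>alternating W j a b\<close> is the product \<open>\<dots> a b\<close> of \<open>j\<close> factors ending in \<open>b\<close>.\<close>

fun alternating :: "('a, 'e) monoid_scheme \<Rightarrow> nat \<Rightarrow> 'a \<Rightarrow> 'a \<Rightarrow> 'a" where
  "alternating W 0 a b = \<one>\<^bsub>W\<^esub>"
| "alternating W (Suc j) a b = alternating W j b a \<otimes>\<^bsub>W\<^esub> b"

text \<open>Formal \<open>A\<close>-linear combinations of symbols \<open>C\<^sub>j\<close>, \<open>j \<ge> 1\<close>, with the convention \<open>C\<^sub>0 = 0\<close>.\<close>

type_synonym formal = "nat \<Rightarrow>\<^sub>0 laurent"

definition Csym :: "nat \<Rightarrow> formal" where
  "Csym j = (if j = 0 then 0 else Poly_Mapping.single j 1)"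

definition formF :: "nat \<Rightarrow> nat \<Rightarrow> formal" where
  "formF i k =
     (if i < k then Csym (k - i) + (\<Sum>r=1..<i. 2 *\<^sub>A Csym (k - i + 2 * r)) + Csym (k + i)
      else if i = k then (\<Sum>r=1..<k. 2 *\<^sub>A Csym (2 * r)) + Csym (2 * k)
      else Csym (i - k) + (\<Sum>r=1..<k. 2 *\<^sub>A Csym (i - k + 2 * r)) + Csym (i + k))"

definition formG :: "nat \<Rightarrow> nat \<Rightarrow> formal" where
  "formG i k =
     (if i \<le> k then (\<Sum>r<i. (vpow 1 + vpow (-1)) *\<^sub>A Csym (k - i + 1 + 2 * r))
      else (\<Sum>r<k. (vpow 1 + vpow (-1)) *\<^sub>A Csym (i - k + 1 + 2 * r)))"

text \<open>
  Every symbol \<open>C\<^sub>m\<^sub>+\<^sub>d\<close> (\<open>0 < d \<le> m\<close>) occurring in \<open>f\<close> with coefficient \<open>a\<close> is taken out together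
  with the same multiple of \<open>C\<^sub>m\<^sub>-\<^sub>d\<close>, and \<open>a (C\<^sub>m\<^sub>+\<^sub>d + C\<^sub>m\<^sub>-\<^sub>d)\<close> is replaced by
  \<open>a (v\<^sup>d + v\<^sup>-\<^sup>d) C\<^sub>m\<close>. The lemmas below show that, for the formulas in question, the required
  multiples of \<open>C\<^sub>m\<^sub>-\<^sub>d\<close> are indeed present and that only genuine symbols \<open>C\<^sub>1, \<dots>, C\<^sub>m\<close> remain.
\<close>

definition replace_pairs :: "nat \<Rightarrow> formal \<Rightarrow> formal" where
  "replace_pairs m f =
     f + (\<Sum>d=1..m. Poly_Mapping.lookup f (m + d) *\<^sub>A
            ((vpow (int d) + vpow (- int d)) *\<^sub>A Csym m - (Csym (m + d) + Csym (m - d))))"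

definition eval_formal :: "(nat \<Rightarrow> 'a hecke) \<Rightarrow> formal \<Rightarrow> 'a hecke" where
  "eval_formal C f = (\<Sum>j\<in>Poly_Mapping.keys f. Poly_Mapping.lookup f j *\<^sub>A C j)"

lemma lookup_scal [simp]: "Poly_Mapping.lookup (a *\<^sub>A f) x = a * Poly_Mapping.lookup f x"
  unfolding scal_def by (simp add: map.rep_eq when_def)

lemma lookup_Csym: "Poly_Mapping.lookup (Csym l) j = (if l = j \<and> j \<noteq> 0 then 1 else 0)"
  by (auto simp: Csym_def lookup_single)

lemma lookup_ladder:
  assumes "finite R"
  shows "Poly_Mapping.lookup (\<Sum>r\<in>R. a *\<^sub>A Csym (l + 2 * r)) j =
    (if j \<noteq> 0 \<and> (\<exists>r\<in>R. j = l + 2 * r) then a else 0)"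
proof (cases "j \<noteq> 0 \<and> (\<exists>r\<in>R. j = l + 2 * r)")
  case True
  then obtain r0 where r0: "r0 \<in> R" "j = l + 2 * r0" by blast
  have "Poly_Mapping.lookup (\<Sum>r\<in>R. a *\<^sub>A Csym (l + 2 * r)) j =
      (\<Sum>r\<in>R. if r = r0 then a else 0)"
    unfolding lookup_sum by (rule sum.cong) (use True r0 in \<open>auto simp: lookup_Csym\<close>)
  then show ?thesis using True r0 assms by simp
next
  case False
  then show ?thesis by (auto simp: lookup_sum lookup_Csym intro!: sum.neutral)
qed

lemma lookup_formF:
  assumes "0 < i" "0 < k"
  shows "Poly_Mapping.lookup (formF i k) j =
    (if j = 0 then 0
     else (if j = nat \<bar>int i - int k\<bar> \<or> j = i + k then 1
     else if (nat \<bar>int i - int k\<bar> < j \<and> j < i + k \<and> even (j + i + k)) then 2 else 0))"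
proof -
  have E: "(\<exists>r\<in>{1..<n}. j = l + 2 * r) \<longleftrightarrow> l < j \<and> j < l + 2 * n \<and> even (j + l)" for l n
  proof
    assume "l < j \<and> j < l + 2 * n \<and> even (j + l)"
    then show "\<exists>r\<in>{1..<n}. j = l + 2 * r"
      by (intro bexI[of _ "(j - l) div 2"]) (auto elim!: evenE oddE)
  qed auto
  have L: "Poly_Mapping.lookup (\<Sum>r=1..<n. 2 *\<^sub>A Csym (l + 2 * r)) j =
    (if l < j \<and> j < l + 2 * n \<and> even (j + l) then 2 else 0)" for l n
    using lookup_ladder[of "{1..<n}" 2 l j] E[of n l] by auto
  have L0: "Poly_Mapping.lookup (\<Sum>r=1..<n. 2 *\<^sub>A Csym (2 * r)) j =
    (if 0 < j \<and> j < 2 * n \<and> even j then 2 else 0)" for n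
    using L[of 0 n] by simp
  consider "i < k" | "i = k" | "k < i" by linarith
  then show ?thesis
  proof cases
    case 1
    then have q: "k - i + 2 * i = i + k" "nat \<bar>int i - int k\<bar> = k - i" "k + i = i + k"
        "even (j + (k - i)) = even (j + i + k)"
      by auto
    have "formF i k = Csym (k - i) + (\<Sum>r=1..<i. 2 *\<^sub>A Csym (k - i + 2 * r)) + Csym (i + k)"
      using 1 by (simp only: formF_def if_True q)
    then show ?thesis using 1 assms by (simp only: lookup_add L q lookup_Csym) auto
  next
    case 2
    have "formF i k = (\<Sum>r=1..<k. 2 *\<^sub>A Csym (2 * r)) + Csym (2 * k)"
      using 2 by (simp only: formF_def less_irrefl if_False if_True simp_thms)
    then show ?thesis using 2 assms by (simp only: lookup_add L0 lookup_Csym) auto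
  next
    case 3
    then have q: "i - k + 2 * k = i + k" "nat \<bar>int i - int k\<bar> = i - k"
        "even (j + (i - k)) = even (j + i + k)" "\<not> i < k" "i \<noteq> k"
      by auto
    have "formF i k = Csym (i - k) + (\<Sum>r=1..<k. 2 *\<^sub>A Csym (i - k + 2 * r)) + Csym (i + k)"
      by (simp only: formF_def if_False q)
    then show ?thesis using 3 assms by (simp only: lookup_add L q lookup_Csym) auto
  qed
qed

lemma lookup_formG:
  assumes "0 < i" "0 < k"
  shows "Poly_Mapping.lookup (formG i k) j =
    (if nat \<bar>int i - int k\<bar> < j \<and> j < i + k \<and> odd (j + i + k)
     then vpow 1 + vpow (-1) else 0)"
proof -
  have E: "(\<exists>r\<in>{..<n}. j = Suc (l + 2 * r)) \<longleftrightarrow> l < j \<and> j < l + 2 * n \<and> odd (j + l)" for l n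
  proof
    assume "l < j \<and> j < l + 2 * n \<and> odd (j + l)"
    then show "\<exists>r\<in>{..<n}. j = Suc (l + 2 * r)"
      by (intro bexI[of _ "(j - l) div 2"]) (auto elim!: oddE evenE)
  qed auto
  have L: "Poly_Mapping.lookup (\<Sum>r<n. a *\<^sub>A Csym (l + 1 + 2 * r)) j =
    (if l < j \<and> j < l + 2 * n \<and> odd (j + l) then a else 0)" for a l n
    using lookup_ladder[of "{..<n}" a "l + 1" j] E[of n l] by auto
  show ?thesis
  proof (cases "i \<le> k")
    case True
    then have q: "k - i + 2 * i = i + k" "nat \<bar>int i - int k\<bar> = k - i"
        "odd (j + (k - i)) = odd (j + i + k)"
      by auto
    show ?thesis using True by (simp only: formG_def if_True L q)
  next
    case False
    then have q: "i - k + 2 * k = i + k" "nat \<bar>int i - int k\<bar> = i - k"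
        "odd (j + (i - k)) = odd (j + i + k)"
      by auto
    show ?thesis using False by (simp only: formG_def if_False L q)
  qed
qed

lemma formF_pairs_available:
  assumes "0 < i" "i \<le> m" "0 < k" "k \<le> m" "0 < d" "d < m"
  shows "Poly_Mapping.lookup (Poly_Mapping.lookup (formF i k) (m + d)) n
       \<le> Poly_Mapping.lookup (Poly_Mapping.lookup (formF i k) (m - d)) n"
proof -
  define q where "q = nat \<bar>int i - int k\<bar>"
  have two: "Poly_Mapping.lookup (2 :: laurent) n = 2 * Poly_Mapping.lookup 1 n"
    by (metis lookup_add mult_2 one_add_one)
  have pos: "0 \<le> Poly_Mapping.lookup (1 :: laurent) n"
    by (simp add: lookup_one when_def)
  have par: "even (m - d + i + k) = even (m + d + i + k)"
    using assms by auto
  have ne: "m + d \<noteq> 0" "m - d \<noteq> 0" "m + d \<noteq> q"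
    using assms by (auto simp: q_def)
  note L = lookup_formF[OF assms(1,3), folded q_def]
  consider (above) "i + k < m + d" | (top) "m + d = i + k" | (inner) "m + d < i + k"
    by linarith
  then show ?thesis
  proof cases
    case above
    then show ?thesis unfolding L using ne pos two by simp
  next
    case top
    then have "even (m + d + i + k)" "q \<le> m - d" "m - d < i + k"
      using assms by (auto simp: q_def)
    then show ?thesis unfolding L using ne pos two par top by simp
  next
    case inner
    then have "q < m - d" "m - d < i + k"
      using assms by (auto simp: q_def)
    then show ?thesis unfolding L using ne pos two par inner by simp
  qed
qed

lemma formG_pairs_available:
  assumes "0 < i" "i \<le> m" "0 < k" "k \<le> m" "0 < d" "d < m"
  shows "Poly_Mapping.lookup (Poly_Mapping.lookup (formG i k) (m + d)) n
       \<le> Poly_Mapping.lookup (Poly_Mapping.lookup (formG i k) (m - d)) n"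
proof -
  define q where "q = nat \<bar>int i - int k\<bar>"
  have pos: "0 \<le> Poly_Mapping.lookup (vpow 1 + vpow (-1)) n"
    by (simp add: vpow_def lookup_add lookup_single when_def)
  have par: "even (m - d + i + k) = even (m + d + i + k)"
    using assms by auto
  note L = lookup_formG[OF assms(1,3), folded q_def]
  show ?thesis
  proof (cases "m + d < i + k")
    case True
    then have "q < m - d" "m - d < i + k"
      using assms by (auto simp: q_def)
    then show ?thesis unfolding L using pos par by simp
  next
    case False
    then show ?thesis unfolding L using pos by simp
  qed
qed

lemma keys_replace_pairs:
  assumes "0 < m" "Poly_Mapping.keys f \<subseteq> {1..2 * m}"
  shows "Poly_Mapping.keys (replace_pairs m f) \<subseteq> {1..m}"
proof
  fix j assume "j \<in> Poly_Mapping.keys (replace_pairs m f)"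
  then have nz: "Poly_Mapping.lookup (replace_pairs m f) j \<noteq> 0"
    by (simp add: in_keys_iff)
  have f0: "Poly_Mapping.lookup f l = 0" if "l = 0 \<or> l > 2 * m" for l
    using assms(2) that by (force simp: in_keys_iff)
  have "j \<noteq> 0"
    using nz f0[of 0]
    by (cases "j = 0") (auto simp: replace_pairs_def lookup_add lookup_sum lookup_minus lookup_Csym)
  moreover have "Poly_Mapping.lookup (replace_pairs m f) j = 0" if "m < j"
  proof -
    have "Poly_Mapping.lookup (replace_pairs m f) j =
      Poly_Mapping.lookup f j + (\<Sum>d=1..m. if d = j - m then - Poly_Mapping.lookup f j else 0)"
      unfolding replace_pairs_def lookup_add lookup_sum
      by (intro arg_cong2[where f = "(+)"] sum.cong refl)
        (use that in \<open>auto simp: lookup_minus lookup_add lookup_Csym\<close>)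
    also have "\<dots> = 0"
      using that f0[of j] by (cases "j \<le> 2 * m") (auto simp: sum.delta)
    finally show ?thesis .
  qed
  ultimately show "j \<in> {1..m}" using nz by (cases "m < j") auto
qed

lemma keys_replace_pairs_formF:
  assumes "0 < i" "i \<le> m" "0 < k" "k \<le> m"
  shows "Poly_Mapping.keys (replace_pairs m (formF i k)) \<subseteq> {1..m}"
  by (rule keys_replace_pairs)
    (use assms in \<open>auto simp: in_keys_iff lookup_formF split: if_splits\<close>)

lemma keys_replace_pairs_formG:
  assumes "0 < i" "i \<le> m" "0 < k" "k \<le> m"
  shows "Poly_Mapping.keys (replace_pairs m (formG i k)) \<subseteq> {1..m}"
  by (rule keys_replace_pairs)
    (use assms in \<open>auto simp: in_keys_iff lookup_formG split: if_splits\<close>)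

end

theory Submission
  imports Defs
begin

text \<open>
  Index the alternating words by the integers, \<open>D n = \<langle>n, a, b]\<close> for \<open>n \<ge> 0\<close> and
  \<open>D (-n) = \<langle>n, b, a]\<close>: the two generators then act on the left by \<open>n \<mapsto> n \<plusminus> 1\<close>, and \<open>D\<close> has
  period \<open>2m\<close>. In a dihedral group \<open>c\<^sub>y\<close> is the sum of \<open>v\<close> to the power \<open>l(x) - l(y)\<close> times
  \<open>t\<^sub>x\<close> over \<open>x \<le> y\<close>, so for the generator \<open>u\<close> that does not start \<open>\<langle>j, a, b]\<close> one has
  \<open>c\<^sub>u C\<^sub>j = C\<^sub>j\<^sub>+\<^sub>1 + C\<^sub>j\<^sub>-\<^sub>1\<close> for \<open>0 < j < m\<close>. Taking this Chebyshev recursion as the definition of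
  \<open>C\<^sub>j\<close> for all \<open>j\<close>, with \<open>C\<^sub>0 = 0\<close>, the replacement rule becomes the identity
  \<open>C\<^sub>m\<^sub>+\<^sub>d + C\<^sub>m\<^sub>-\<^sub>d = (v\<^sup>d + v\<^sup>-\<^sup>d) C\<^sub>m\<close>, which holds because \<open>c\<^sub>u C\<^sub>m = (v + v\<^sup>-\<^sup>1) C\<^sub>m\<close> for both
  generators \<open>u\<close>. Extending \<open>C\<close> to an odd function of an integer index, the products telescope to
  sums of \<open>i\<close> consecutive terms in steps of 2 centred at \<open>k\<close>; oddness makes such sums symmetric in
  \<open>i\<close> and \<open>k\<close>, which gives the different shapes for \<open>i < k\<close> and \<open>i > k\<close>.
\<close>

section \<open>Alternating words indexed by the integers\<close>

definition altz :: "('a, 'e) monoid_scheme \<Rightarrow> 'a \<Rightarrow> 'a \<Rightarrow> int \<Rightarrow> 'a" where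
  "altz W a b n = (if n \<ge> 0 then alternating W (nat n) a b else alternating W (nat (- n)) b a)"

text \<open>The generator that carries \<open>D n\<close> to \<open>D (n + 1)\<close>. Only the
  parity of the index enters, so \<open>n\<close> and \<open>- n\<close> have the same
  letter.\<close>

definition letter :: "'a \<Rightarrow> 'a \<Rightarrow> int \<Rightarrow> 'a" where
  "letter a b n = (if even n then b else a)"

lemma altz_swap: "altz W b a n = altz W a b (- n)"
  by (auto simp: altz_def)

lemma altz_of_nat [simp]: "altz W a b (int j) = alternating W j a b"
  by (simp add: altz_def)

lemma altz_0 [simp]: "altz W a b 0 = \<one>\<^bsub>W\<^esub>"
  by (simp add: altz_def)

lemma letter_cong: "even (n - n') \<Longrightarrow> letter a b n = letter a b n'"
  by (auto simp: letter_def)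

locale dihedral = group W for W :: "('a, 'e) monoid_scheme" (structure) +
  fixes a b :: 'a and m :: nat
  assumes dihedral: "dihedral_group W a b m" and m_pos: "0 < m"
begin

abbreviation D where "D \<equiv> altz W a b"
abbreviation L where "L \<equiv> letter a b"
abbreviation len where "len \<equiv> cox_length W {a, b}"

lemma gens: "a \<in> carrier W" "b \<in> carrier W" "a \<noteq> b" "a \<noteq> \<one>" "b \<noteq> \<one>"
    "a \<otimes> a = \<one>" "b \<otimes> b = \<one>" "generate W {a, b} = carrier W" "order W = 2 * m"
  using dihedral by (auto simp: dihedral_group_def)

lemma L_closed [simp]: "L n \<in> carrier W" and L_in [simp]: "L n \<in> {a, b}" and L_ne_one: "L n \<noteq> \<one>"
  and L_invol: "L n \<otimes> L n = \<one>"
  using gens by (auto simp: letter_def)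

lemma L_cancel [simp]: "x \<in> carrier W \<Longrightarrow> L n \<otimes> (L n \<otimes> x) = x"
  by (simp flip: m_assoc add: L_invol)

lemma alternating_closed [simp]:
  "alternating W j a b \<in> carrier W" "alternating W j b a \<in> carrier W"
  by (induction j) (use gens in auto)

lemma D_closed [simp]: "D n \<in> carrier W"
  by (simp add: altz_def)

lemma alternating_Suc_left:
  "alternating W (Suc j) a b = (if even j then b else a) \<otimes> alternating W j a b \<and>
   alternating W (Suc j) b a = (if even j then a else b) \<otimes> alternating W j b a"
  using gens by (induction j) (auto simp: m_assoc)

lemma D_succ: "D (n + 1) = L n \<otimes> D n"
proof (cases "n \<ge> 0")
  case True
  then obtain j where "n = int j" by (metis nonneg_int_cases)
  then show ?thesis
    using alternating_Suc_left[of j] altz_of_nat[of W a b "Suc j"]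
    by (simp add: letter_def add.commute del: alternating.simps)
next
  case False
  define j where "j = nat (- n) - 1"
  have n: "n = - int (Suc j)" using False by (simp add: j_def)
  have "D n = alternating W (Suc j) b a" "D (n + 1) = alternating W j b a"
    using altz_swap[of W b a "int (Suc j)"] altz_swap[of W b a "int j"] altz_of_nat[of W b a "Suc j"]
    by (auto simp: n simp del: alternating.simps)
  moreover have "L n = (if even j then a else b)"
    by (auto simp: letter_def n)
  ultimately show ?thesis
    using alternating_Suc_left[of j] L_cancel[of "alternating W j b a" n] by simp
qed

lemma D_pred: "D (n - 1) = L (n - 1) \<otimes> D n"
  using D_succ[of "n - 1"] by simp

section \<open>Coincidences among the words and their period\<close>

lemma D_ne_odd: "D n \<noteq> D (n + 2 * int j + 1)"
proof (induction j arbitrary: n)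
  case 0
  show ?case
    using L_ne_one[of n] by (simp add: D_succ)
next
  case (Suc j)
  \<comment> \<open>Multiplying both sides by the same letter moves the left index up and the right
    index down. The odd gap shrinks by two; at gap one, a letter would have to be the
    identity.\<close>
  have "D (n + 1) = D (n + 1 + 2 * int j + 1)" if "D n = D (n + 2 * int (Suc j) + 1)"
  proof -
    have "D (n + 1 + 2 * int j + 1) = L (n + 2 * int (Suc j)) \<otimes> D (n + 2 * int (Suc j) + 1)"
      using D_pred[of "n + 2 * int (Suc j) + 1"] by (simp add: algebra_simps)
    also have "L (n + 2 * int (Suc j)) = L n"
      by (rule letter_cong) simp
    finally show ?thesis using that by (simp add: D_succ)
  qed
  then show ?case using Suc by blast
qed

lemma D_eq_even: "D n = D n' \<Longrightarrow> even (n - n')"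
proof (rule ccontr)
  assume eq: "D n = D n'" and odd: "odd (n - n')"
  have *: False if "D x = D y" "odd (y - x)" "x \<le> y" for x y
  proof -
    obtain z where "y - x = 2 * z + 1" using \<open>odd (y - x)\<close> by (elim oddE)
    then have "y = x + 2 * int (nat z) + 1" using \<open>x \<le> y\<close> by simp
    then show False using D_ne_odd that by blast
  qed
  show False
    using *[of n n'] *[of n' n] eq odd by (cases "n \<le> n'") auto
qed

text \<open>By \<open>D_eq_even\<close> the two indices have the same parity, so the same letter
  moves both words up and the same letter moves both down. Hence the indices of the identity form a
  subgroup of the integers.\<close>

lemma D_shift:
  assumes "D n = D n'"
  shows "D (n + k) = D (n' + k)"
proof (induction k rule: int_induct[of _ 0])
  case base
  show ?case using assms by simp
next
  case (step1 k)
  have "L (n + k) = L (n' + k)" using D_eq_even[OF assms] by (intro letter_cong) simp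
  then show ?case using step1 D_succ[of "n + k"] D_succ[of "n' + k"] by (simp add: add.assoc)
next
  case (step2 k)
  have "L (n + k - 1) = L (n' + k - 1)" using D_eq_even[OF assms] by (intro letter_cong) simp
  then show ?case using step2 D_pred[of "n + k"] D_pred[of "n' + k"] by (simp add: algebra_simps)
qed

lemma L_mult_D: "u \<in> {a, b} \<Longrightarrow> u \<otimes> D n = D (n + 1) \<or> u \<otimes> D n = D (n - 1)"
  unfolding D_succ D_pred by (auto simp: letter_def)

text \<open>The range of \<open>D\<close> contains the identity and is stable under left
  multiplication by each generator, hence by everything they generate.\<close>

lemma carrier_eq: "carrier W = range D"
proof -
  have "\<exists>k. g \<otimes> D n = D k" if "g \<in> generate W {a, b}" for g n
    using that
  proof (induction arbitrary: n rule: generate.induct)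
    case one
    then show ?case by auto
  next
    case (incl h)
    then show ?case using L_mult_D by blast
  next
    case (inv h)
    then have "inv h = h" using gens by (metis insertE inv_equality singletonD)
    then show ?case using inv L_mult_D by metis
  next
    case (eng h1 h2)
    have "h1 \<in> carrier W" "h2 \<in> carrier W" using eng gens by auto
    then show ?case using eng(3,4) m_assoc D_closed by metis
  qed
  from this[of _ 0] have "g \<in> range D" if "g \<in> carrier W" for g
    using that gens(8) by (metis altz_0 r_one rangeI)
  then show ?thesis by auto
qed

text \<open>The indices of the identity form a nonzero subgroup \<open>Z\<close>, generated by its
  least positive element \<open>P\<close>. One period of \<open>D\<close> lists the group without
  repetition, so \<open>P\<close> is the group order \<open>2 * m\<close>.\<close>

lemma D_eq_iff: "D n = D n' \<longleftrightarrow> int (2 * m) dvd n - n'"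
proof -
  define Z where "Z = {p. D p = \<one>}"
  have Z_iff: "D x = D y \<longleftrightarrow> x - y \<in> Z" for x y
    using D_shift[of x y "- y"] D_shift[of "x - y" 0 y] by (auto simp: Z_def)
  have card: "card (carrier W) = 2 * m" using gens by (simp add: order_def)
  then have fin: "finite (carrier W)" using m_pos by (metis card.infinite mult_eq_0_iff neq0_conv zero_neq_numeral)
  have "\<not> inj D"
    using fin finite_imageD[of D UNIV] carrier_eq infinite_UNIV_int by metis
  then obtain x y where "D x = D y" "x < y"
    unfolding inj_def by (metis linorder_neqE)
  then have ex: "\<exists>q. 0 < q \<and> int q \<in> Z"
    using Z_iff[of y x] by (intro exI[of _ "nat (y - x)"]) auto
  define P where "P = (LEAST q. 0 < q \<and> int q \<in> Z)"
  have P: "0 < P" "int P \<in> Z" using LeastI_ex[OF ex] by (auto simp: P_def)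
  have least: "P \<le> q" if "0 < q" "int q \<in> Z" for q
    using that Least_le[of "\<lambda>q. 0 < q \<and> int q \<in> Z"] by (auto simp: P_def)
  have mult: "D (n + q * int P) = D n" for q n
  proof (induction q rule: int_induct[of _ 0])
    case (step1 i)
    then show ?case using Z_iff[of "n + (i + 1) * int P" "n + i * int P"] P by (simp add: algebra_simps)
  next
    case (step2 i)
    then show ?case using Z_iff[of "n + i * int P" "n + (i - 1) * int P"] P by (simp add: algebra_simps)
  qed simp
  have mod: "D n = D (n mod int P)" for n
    using mult[of "n mod int P" "n div int P"] by simp
  have Z_dvd: "z \<in> Z \<longleftrightarrow> int P dvd z" for z
  proof
    assume "z \<in> Z"
    then have "z mod int P \<in> Z" using mod[of z] by (simp add: Z_def)
    moreover have "z mod int P < int P" using P by simp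
    ultimately have "\<not> 0 < z mod int P"
      using least[of "nat (z mod int P)"] by force
    moreover have "0 \<le> z mod int P" using P by simp
    ultimately show "int P dvd z" by (simp add: dvd_eq_mod_eq_0)
  next
    assume "int P dvd z"
    then show "z \<in> Z" using mult[of 0] by (auto simp: Z_def mult.commute elim!: dvdE)
  qed
  have "carrier W = D ` {0..<int P}"
    using carrier_eq mod P by (auto simp: image_iff) (metis atLeastLessThan_iff of_nat_0_less_iff pos_mod_bound pos_mod_sign)
  moreover have "inj_on D {0..<int P}"
  proof (rule inj_onI)
    fix x y assume "x \<in> {0..<int P}" "y \<in> {0..<int P}" "D x = D y"
    moreover from this have "int P dvd x - y" using Z_iff Z_dvd by blast
    ultimately show "x = y"
      by (metis atLeastLessThan_iff mod_eq_dvd_iff mod_pos_pos_trivial)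
  qed
  ultimately have "P = 2 * m" using card by (simp add: card_image)
  then show ?thesis using Z_iff Z_dvd by simp
qed

text \<open>A nonzero multiple of the period has absolute value at least \<open>2 * m\<close>. Thus,
  among indices of absolute value at most \<open>m\<close>, only \<open>m\<close> and
  \<open>- m\<close> can give the same element.\<close>

lemma D_eq_small: "D n = D n' \<Longrightarrow> \<bar>n\<bar> + \<bar>n'\<bar> < 2 * int m \<Longrightarrow> n = n'"
  using D_eq_iff[of n n'] dvd_imp_le_int[of "n - n'" "int (2 * m)"] by force

lemma D_m: "D (- int m) = D (int m)"
  by (subst D_eq_iff) simp

lemma D_range:
  assumes "x \<in> carrier W"
  obtains n where "x = D n" "\<bar>n\<bar> \<le> int m"
proof -
  obtain k where k: "x = D k" using assms carrier_eq by auto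
  define r where "r = k mod (2 * int m)"
  have r: "0 \<le> r" "r < 2 * int m" "D r = D k" "D (r - 2 * int m) = D k"
    using m_pos by (auto simp: r_def D_eq_iff mod_eq_dvd_iff[symmetric] simp del: altz_of_nat)
  show thesis
    by (cases "r \<le> int m") (use r k that[of r] that[of "r - 2 * int m"] in auto)
qed

section \<open>Length and Bruhat order through indices\<close>

lemma word_product_D:
  "set ws \<subseteq> {a, b} \<Longrightarrow> \<exists>n. word_product W ws = D n \<and> \<bar>n\<bar> \<le> int (length ws)"
proof (induction ws)
  case Nil
  show ?case by (auto simp: word_product_def intro: exI[of _ 0])
next
  case (Cons x ws)
  then obtain n where n: "word_product W ws = D n" "\<bar>n\<bar> \<le> int (length ws)" by auto
  have "word_product W (x # ws) = x \<otimes> D n" using n by (simp add: word_product_def)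
  moreover have "x \<in> {a, b}" using Cons by auto
  ultimately obtain k where "word_product W (x # ws) = D k" "\<bar>k\<bar> \<le> \<bar>n\<bar> + 1"
    using L_mult_D[of x n] by (metis abs_triangle_ineq abs_triangle_ineq4 abs_one)
  then show ?case using n by auto
qed

lemma D_word: "\<exists>ws. set ws \<subseteq> {a, b} \<and> length ws = nat \<bar>n\<bar> \<and> word_product W ws = D n"
proof (induction n rule: int_induct[of _ 0])
  case base
  show ?case by (auto simp: word_product_def)
next
  case (step1 k)
  then obtain ws where "set ws \<subseteq> {a, b}" "length ws = nat \<bar>k\<bar>" "word_product W ws = D k" by blast
  then show ?case using step1 L_in[of k]
    by (intro exI[of _ "L k # ws"]) (auto simp: word_product_def D_succ)
next
  case (step2 k)
  then obtain ws where "set ws \<subseteq> {a, b}" "length ws = nat \<bar>k\<bar>" "word_product W ws = D k" by blast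
  then show ?case using step2 L_in[of "k - 1"]
    by (intro exI[of _ "L (k - 1) # ws"]) (auto simp: word_product_def D_pred)
qed

text \<open>Each letter changes the index by one, so \<open>l\<close> letters reach only indices of
  absolute value at most \<open>l\<close>. An index of \<open>D n\<close> of absolute value below
  that of \<open>n\<close> is excluded by \<open>D_eq_small\<close>.\<close>

lemma len_D: "\<bar>n\<bar> \<le> int m \<Longrightarrow> len (D n) = nat \<bar>n\<bar>"
  unfolding cox_length_def
proof (rule Least_equality)
  fix l assume n: "\<bar>n\<bar> \<le> int m" and "\<exists>ws. set ws \<subseteq> {a, b} \<and> length ws = l \<and> word_product W ws = D n"
  then obtain k where k: "D n = D k" "\<bar>k\<bar> \<le> int l" using word_product_D by metis
  show "nat \<bar>n\<bar> \<le> l"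
    using D_eq_small[OF k(1)] k(2) n by force
qed (rule D_word)

text \<open>Bruhat steps multiply by reflections on the right, the Hecke relations by generators on
  the left. The conjugate \<open>inv y \<otimes> u \<otimes> y\<close> translates between the
  two.\<close>

lemma bruhat_less_left:
  assumes "u \<in> {a, b}" "y \<in> carrier W" "len y < len (u \<otimes> y)"
  shows "bruhat_less W {a, b} y (u \<otimes> y)"
proof -
  have u: "u \<in> carrier W" using assms gens by auto
  have "inv y \<otimes> u \<otimes> y \<in> reflections W {a, b}"
    unfolding reflections_def using assms
    by (intro CollectI exI[of _ "inv y"] exI[of _ u]) auto
  moreover have "u \<otimes> y = y \<otimes> (inv y \<otimes> u \<otimes> y)"
    using assms(2) u by (simp flip: m_assoc)
  ultimately show ?thesis
    unfolding bruhat_less_def using assms by (intro tranclp.r_into_trancl) auto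
qed

text \<open>Exchanging the generators negates the index of \<open>D\<close>. This symmetry supplies
  the statements about words with the other last letter.\<close>

lemma dihedral_swap: "dihedral W b a m"
  using dihedral m_pos
  by unfold_locales (auto simp: dihedral_group_def insert_commute)

end

section \<open>Laurent polynomials and the free module\<close>

interpretation scal: Modules.module "scal :: laurent \<Rightarrow> ('b \<Rightarrow>\<^sub>0 laurent) \<Rightarrow> ('b \<Rightarrow>\<^sub>0 laurent)"
  by unfold_locales (auto intro!: poly_mapping_eqI simp: lookup_add algebra_simps)

lemma vpow_add: "vpow i * vpow j = vpow (i + j)"
  by (simp add: vpow_def mult_single)

lemma vpow_0 [simp]: "vpow 0 = 1"
  by (simp add: vpow_def)

lemma vpow_inverse: "vpow 1 * vpow (- 1) = 1"
  by (simp add: vpow_add)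

lemma vpow_cancel: "vpow 1 * (vpow (- 1) * x) = x" "vpow (- 1) * (vpow 1 * x) = x"
  by (simp_all flip: mult.assoc add: vpow_add)

lemma keys_scal: "Poly_Mapping.keys (p *\<^sub>A f) \<subseteq> Poly_Mapping.keys f"
  by (auto simp: in_keys_iff)

lemma lookup_tbasis: "Poly_Mapping.lookup (tbasis x) y = (if x = y then 1 else 0)"
  by (auto simp: tbasis_def lookup_single)

lemma poly_mapping_eq_sum_tbasis:
  "f = (\<Sum>x\<in>Poly_Mapping.keys f. Poly_Mapping.lookup f x *\<^sub>A tbasis x)"
  by (rule poly_mapping_eqI)
    (auto simp: lookup_sum lookup_tbasis in_keys_iff if_distrib[of "\<lambda>z. _ * z"] cong: if_cong)

section \<open>The substitution of v^-1 for v, and polynomials in negative powers\<close>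

definition bar :: "laurent \<Rightarrow> laurent" where
  "bar p = Poly_Mapping.map_key uminus p"

lemma lookup_bar: "Poly_Mapping.lookup (bar p) n = Poly_Mapping.lookup p (- n)"
  by (simp add: bar_def map_key.rep_eq)

lemma bar_vpow [simp]: "bar (vpow n) = vpow (- n)"
  by (rule poly_mapping_eqI) (auto simp: lookup_bar vpow_def lookup_single when_def)

lemma bar_diff: "bar (p - q) = bar p - bar q"
  by (rule poly_mapping_eqI) (simp add: lookup_bar lookup_minus)

lemma bar_0 [simp]: "bar 0 = 0"
  by (rule poly_mapping_eqI) (simp add: lookup_bar)

text \<open>Of two exponents n and -n one is nonnegative, where \<open>p\<close> has coefficient
  zero; invariance carries this zero to the other.\<close>

lemma neg_laurent_bar_fixed:
  assumes "p \<in> neg_laurent" "bar p = p"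
  shows "p = 0"
proof (rule poly_mapping_eqI)
  fix n
  have neg: "Poly_Mapping.lookup p k = 0" if "k \<ge> 0" for k
    using assms(1) that by (force simp: neg_laurent_def in_keys_iff)
  have "Poly_Mapping.lookup p n = Poly_Mapping.lookup p (- n)"
    using assms(2) by (metis lookup_bar)
  then show "Poly_Mapping.lookup p n = Poly_Mapping.lookup 0 n"
    using neg[of n] neg[of "- n"] by (cases "n \<ge> 0") auto
qed

lemma neg_laurent_0: "0 \<in> neg_laurent"
  and neg_laurent_vpow: "vpow (- 1) \<in> neg_laurent"
  by (auto simp: neg_laurent_def vpow_def)

lemma neg_laurent_add: "p \<in> neg_laurent \<Longrightarrow> q \<in> neg_laurent \<Longrightarrow> p + q \<in> neg_laurent"
  using keys_add[of p q] by (auto simp: neg_laurent_def)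

lemma neg_laurent_diff: "p \<in> neg_laurent \<Longrightarrow> q \<in> neg_laurent \<Longrightarrow> p - q \<in> neg_laurent"
  using keys_diff[of p q] by (auto simp: neg_laurent_def)

lemma neg_laurent_mult: "p \<in> neg_laurent \<Longrightarrow> q \<in> neg_laurent \<Longrightarrow> p * q \<in> neg_laurent"
  using keys_mult[of p q] by (force simp: neg_laurent_def)

section \<open>The Hecke algebra of a dihedral group\<close>

text \<open>For \<open>j \<le> m\<close> this is the sum of \<open>v\<close> to the power \<open>l(x) - j\<close> times \<open>t\<^sub>x\<close> over all \<open>x\<close> with \<open>l(x) < j\<close>.\<close>

fun lower_sum :: "('a, 'e) monoid_scheme \<Rightarrow> 'a \<Rightarrow> 'a \<Rightarrow> nat \<Rightarrow> 'a hecke" where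
  "lower_sum W a b 0 = 0"
| "lower_sum W a b (Suc 0) = vpow (- 1) *\<^sub>A tbasis (altz W a b 0)"
| "lower_sum W a b (Suc (Suc j)) = vpow (- 1) *\<^sub>A (lower_sum W a b (Suc j)
     + tbasis (altz W a b (int (Suc j))) + tbasis (altz W a b (- int (Suc j))))"

lemma lower_sum_swap: "lower_sum W b a j = lower_sum W a b j"
proof (induction j rule: induct_nat_012)
  case (ge2 n)
  then show ?case
    using altz_swap[of W b a "int (Suc n)"] altz_swap[of W b a "- int (Suc n)"]
    by (simp only: lower_sum.simps minus_minus ac_simps)
qed simp_all

text \<open>The Kazhdan-Lusztig element of a generator \<open>u\<close>, written \<open>c_u\<close>
  below.\<close>

definition cgen :: "('a hecke) ring \<Rightarrow> 'a \<Rightarrow> 'a hecke" where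
  "cgen H u = tbasis u + vpow (- 1) *\<^sub>A \<one>\<^bsub>H\<^esub>"

locale dihedral_hecke = dihedral W a b m + hecke_algebra W "{a, b}" H
  for W :: "('a, 'e) monoid_scheme" (structure) and a b m and H :: "'a hecke ring"
begin

lemma swap: "dihedral_hecke W b a m H"
  using dihedral_swap hecke_algebra_axioms
  by (simp add: dihedral_hecke_def insert_commute)

abbreviation T where "T n \<equiv> tbasis (D n)"

lemma add_closed [simp]: "f \<in> carrier H \<Longrightarrow> g \<in> carrier H \<Longrightarrow> f + g \<in> carrier H"
  using keys_add[of f g] by (auto simp: carrier_H)

lemma diff_closed [simp]: "f \<in> carrier H \<Longrightarrow> g \<in> carrier H \<Longrightarrow> f - g \<in> carrier H"
  using keys_diff[of f g] by (auto simp: carrier_H)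

lemma zero_closed [simp]: "0 \<in> carrier H"
  by (simp add: carrier_H)

lemma scal_closed [simp]: "f \<in> carrier H \<Longrightarrow> p *\<^sub>A f \<in> carrier H"
  using keys_scal[of p f] by (auto simp: carrier_H)

lemma tbasis_closed [simp]: "x \<in> carrier W \<Longrightarrow> tbasis x \<in> carrier H"
  by (auto simp: carrier_H tbasis_def)

lemma sum_closed: "(\<And>x. x \<in> Q \<Longrightarrow> f x \<in> carrier H) \<Longrightarrow> sum f Q \<in> carrier H"
  by (induction Q rule: infinite_finite_induct) auto

lemma lower_sum_closed [simp]: "lower_sum W a b j \<in> carrier H"
  by (induction j rule: induct_nat_012) simp_all

lemma zero_H: "\<zero>\<^bsub>H\<^esub> = 0"
  using H.l_zero[of 0] add_H[of "\<zero>\<^bsub>H\<^esub>" 0] by simp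

lemma mult_add_left [simp]: "\<lbrakk>f \<in> carrier H; g \<in> carrier H; h \<in> carrier H\<rbrakk> \<Longrightarrow>
    (f + g) \<otimes>\<^bsub>H\<^esub> h = f \<otimes>\<^bsub>H\<^esub> h + g \<otimes>\<^bsub>H\<^esub> h"
  using H.l_distr[of f g h] by (simp add: add_H)

lemma mult_add_right [simp]: "\<lbrakk>f \<in> carrier H; g \<in> carrier H; h \<in> carrier H\<rbrakk> \<Longrightarrow>
    h \<otimes>\<^bsub>H\<^esub> (f + g) = h \<otimes>\<^bsub>H\<^esub> f + h \<otimes>\<^bsub>H\<^esub> g"
  using H.r_distr[of f g h] by (simp add: add_H)

lemma mult_diff_left [simp]: "\<lbrakk>f \<in> carrier H; g \<in> carrier H; h \<in> carrier H\<rbrakk> \<Longrightarrow>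
    (f - g) \<otimes>\<^bsub>H\<^esub> h = f \<otimes>\<^bsub>H\<^esub> h - g \<otimes>\<^bsub>H\<^esub> h"
  using mult_add_left[of "f - g" g h] by (simp del: mult_add_left)

lemma mult_diff_right [simp]: "\<lbrakk>f \<in> carrier H; g \<in> carrier H; h \<in> carrier H\<rbrakk> \<Longrightarrow>
    h \<otimes>\<^bsub>H\<^esub> (f - g) = h \<otimes>\<^bsub>H\<^esub> f - h \<otimes>\<^bsub>H\<^esub> g"
  using mult_add_right[of "f - g" g h] by (simp del: mult_add_right)

lemma mult_zero [simp]: "f \<in> carrier H \<Longrightarrow> f \<otimes>\<^bsub>H\<^esub> 0 = 0" "f \<in> carrier H \<Longrightarrow> 0 \<otimes>\<^bsub>H\<^esub> f = 0"
  using H.r_null[of f] H.l_null[of f] by (simp_all add: zero_H)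

declare scal_left [simp] scal_right [simp]

lemma mult_sum_right:
  "h \<in> carrier H \<Longrightarrow> (\<And>x. x \<in> Q \<Longrightarrow> f x \<in> carrier H) \<Longrightarrow>
    h \<otimes>\<^bsub>H\<^esub> (\<Sum>x\<in>Q. f x) = (\<Sum>x\<in>Q. h \<otimes>\<^bsub>H\<^esub> f x)"
  by (induction Q rule: infinite_finite_induct) (auto simp: sum_closed)

lemma mult_sum_left:
  "h \<in> carrier H \<Longrightarrow> (\<And>x. x \<in> Q \<Longrightarrow> f x \<in> carrier H) \<Longrightarrow>
    (\<Sum>x\<in>Q. f x) \<otimes>\<^bsub>H\<^esub> h = (\<Sum>x\<in>Q. f x \<otimes>\<^bsub>H\<^esub> h)"
  by (induction Q rule: infinite_finite_induct) (auto simp: sum_closed)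

section \<open>Generators acting on the standard basis, and the unit\<close>

lemma t_up:
  assumes "u \<in> {a, b}" "y \<in> carrier W" "len (u \<otimes> y) = Suc (len y)"
  shows "tbasis u \<otimes>\<^bsub>H\<^esub> tbasis y = tbasis (u \<otimes> y)"
    and "tbasis u \<otimes>\<^bsub>H\<^esub> tbasis (u \<otimes> y) = (vpow 1 - vpow (- 1)) *\<^sub>A tbasis (u \<otimes> y) + tbasis y"
proof -
  have u: "u \<in> carrier W" "u \<otimes> u = \<one>" using assms(1) gens by auto
  then have uu: "u \<otimes> (u \<otimes> y) = y" using assms(2) by (simp flip: m_assoc)
  have "bruhat_less W {a, b} y (u \<otimes> y)" using assms bruhat_less_left by simp
  then show "tbasis u \<otimes>\<^bsub>H\<^esub> tbasis y = tbasis (u \<otimes> y)"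
    and "tbasis u \<otimes>\<^bsub>H\<^esub> tbasis (u \<otimes> y) = (vpow 1 - vpow (- 1)) *\<^sub>A tbasis (u \<otimes> y) + tbasis y"
    using t_mult_up[of u y] t_mult_down[of u "u \<otimes> y"] assms u uu by auto
qed

text \<open>The letter \<open>L n\<close> exchanges the words with indices \<open>n\<close> and
  \<open>n + 1\<close>. The longer one is \<open>D (n + 1)\<close> for \<open>n \<ge> 0\<close> and
  \<open>D n\<close> for \<open>n < 0\<close>; the bounds keep both indices in the range of
  \<open>len_D\<close>.\<close>

lemma t_mult_D:
  "0 \<le> n \<Longrightarrow> n < int m \<Longrightarrow> tbasis (L n) \<otimes>\<^bsub>H\<^esub> T n = T (n + 1)"
  "0 \<le> n \<Longrightarrow> n < int m \<Longrightarrow>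
     tbasis (L n) \<otimes>\<^bsub>H\<^esub> T (n + 1) = (vpow 1 - vpow (- 1)) *\<^sub>A T (n + 1) + T n"
  "n < 0 \<Longrightarrow> - int m \<le> n \<Longrightarrow> tbasis (L n) \<otimes>\<^bsub>H\<^esub> T (n + 1) = T n"
  "n < 0 \<Longrightarrow> - int m \<le> n \<Longrightarrow>
     tbasis (L n) \<otimes>\<^bsub>H\<^esub> T n = (vpow 1 - vpow (- 1)) *\<^sub>A T n + T (n + 1)"
proof -
  have up: "len (L n \<otimes> D n) = Suc (len (D n))" if "0 \<le> n" "n < int m"
    using that len_D[of n] len_D[of "n + 1"] by (simp flip: D_succ add: nat_add_distrib)
  have down: "len (L n \<otimes> D (n + 1)) = Suc (len (D (n + 1)))" if "n < 0" "- int m \<le> n"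
    using that len_D[of n] len_D[of "n + 1"] D_pred[of "n + 1"] by (simp add: D_succ)
  show "0 \<le> n \<Longrightarrow> n < int m \<Longrightarrow> tbasis (L n) \<otimes>\<^bsub>H\<^esub> T n = T (n + 1)"
    "0 \<le> n \<Longrightarrow> n < int m \<Longrightarrow>
       tbasis (L n) \<otimes>\<^bsub>H\<^esub> T (n + 1) = (vpow 1 - vpow (- 1)) *\<^sub>A T (n + 1) + T n"
    using t_up[OF L_in D_closed up] by (simp_all add: D_succ)
  show "n < 0 \<Longrightarrow> - int m \<le> n \<Longrightarrow> tbasis (L n) \<otimes>\<^bsub>H\<^esub> T (n + 1) = T n"
    "n < 0 \<Longrightarrow> - int m \<le> n \<Longrightarrow>
       tbasis (L n) \<otimes>\<^bsub>H\<^esub> T n = (vpow 1 - vpow (- 1)) *\<^sub>A T n + T (n + 1)"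
    using t_up[OF L_in D_closed down] D_pred[of "n + 1"] by simp_all
qed

text \<open>Preparation for \<open>one_H\<close>: the axioms of \<open>H\<close> speak of a unit
  without saying which element it is.\<close>

lemma t_one_right_D: "\<bar>n\<bar> \<le> int m \<Longrightarrow> T n \<otimes>\<^bsub>H\<^esub> T 0 = T n"
proof (induction n rule: int_induct[of _ 0])
  case base
  have T1: "T 1 = tbasis (L 0)" using D_succ[of 0] by simp
  have sq: "T 1 \<otimes>\<^bsub>H\<^esub> T 1 = (vpow 1 - vpow (- 1)) *\<^sub>A T 1 + T 0"
    and id: "T 1 \<otimes>\<^bsub>H\<^esub> T 0 = T 1"
    using t_mult_D(1,2)[of 0] m_pos by (simp_all add: T1)
  \<comment> \<open>Bracketing \<open>T 1\<close>, \<open>T 1\<close>, \<open>T 0\<close> in two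
    ways and expanding the square leaves \<open>T 0\<close> times \<open>T 0\<close> equal to
    \<open>T 0\<close>, a product that the Hecke relations do not give directly.\<close>
  have "T 1 \<otimes>\<^bsub>H\<^esub> T 1 \<otimes>\<^bsub>H\<^esub> T 0 = T 1 \<otimes>\<^bsub>H\<^esub> T 1"
    using id by (simp add: H.m_assoc del: altz_0)
  then show ?case using id by (simp add: sq del: altz_0)
next
  case (step1 k)
  then have "T (k + 1) = tbasis (L k) \<otimes>\<^bsub>H\<^esub> T k" using t_mult_D(1)[of k] by simp
  then show ?case using step1 by (simp add: H.m_assoc del: altz_0)
next
  case (step2 k)
  then have "T (k - 1) = tbasis (L (k - 1)) \<otimes>\<^bsub>H\<^esub> T k" using t_mult_D(3)[of "k - 1"] by simp
  then show ?case using step2 by (simp add: H.m_assoc del: altz_0)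
qed

text \<open>Expanding the unit in the standard basis shows that \<open>T 0\<close> fixes it from the
  right; the same product is \<open>T 0\<close>.\<close>

lemma one_H: "\<one>\<^bsub>H\<^esub> = T 0"
proof -
  let ?e = "\<one>\<^bsub>H\<^esub>"
  have sub: "Poly_Mapping.keys ?e \<subseteq> carrier W" using H.one_closed carrier_H by auto
  have "(\<Sum>x\<in>Poly_Mapping.keys ?e. Poly_Mapping.lookup ?e x *\<^sub>A tbasis x) \<otimes>\<^bsub>H\<^esub> T 0 =
        (\<Sum>x\<in>Poly_Mapping.keys ?e. Poly_Mapping.lookup ?e x *\<^sub>A tbasis x)"
  proof (subst mult_sum_left)
    fix x assume "x \<in> Poly_Mapping.keys ?e"
    then show "Poly_Mapping.lookup ?e x *\<^sub>A tbasis x \<in> carrier H" using sub by auto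
  next
    show "(\<Sum>x\<in>Poly_Mapping.keys ?e. (Poly_Mapping.lookup ?e x *\<^sub>A tbasis x) \<otimes>\<^bsub>H\<^esub> T 0) =
      (\<Sum>x\<in>Poly_Mapping.keys ?e. Poly_Mapping.lookup ?e x *\<^sub>A tbasis x)"
    proof (rule sum.cong)
      fix x assume "x \<in> Poly_Mapping.keys ?e"
      with sub obtain n where "x = D n" "\<bar>n\<bar> \<le> int m" using D_range by (metis subsetD)
      then show "(Poly_Mapping.lookup ?e x *\<^sub>A tbasis x) \<otimes>\<^bsub>H\<^esub> T 0 = Poly_Mapping.lookup ?e x *\<^sub>A tbasis x"
        by (simp add: t_one_right_D del: altz_0)
    qed simp
  qed (simp del: altz_0)
  then have "?e \<otimes>\<^bsub>H\<^esub> T 0 = ?e"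
    using poly_mapping_eq_sum_tbasis[of ?e] by simp
  then show ?thesis by simp
qed

section \<open>Products with the elements \<open>c_u\<close>\<close>

lemma cgen_closed [simp]: "u \<in> {a, b} \<Longrightarrow> cgen H u \<in> carrier H"
  using gens by (auto simp: cgen_def)

lemma cgen_L_closed [simp]: "cgen H (L n) \<in> carrier H"
  by (rule cgen_closed) (rule L_in)

lemma cgen_mult: "u \<in> {a, b} \<Longrightarrow> f \<in> carrier H \<Longrightarrow>
    cgen H u \<otimes>\<^bsub>H\<^esub> f = tbasis u \<otimes>\<^bsub>H\<^esub> f + vpow (- 1) *\<^sub>A f"
  using gens by (auto simp: cgen_def)

lemma cgen_mult_D:
  "0 \<le> n \<Longrightarrow> n < int m \<Longrightarrow> cgen H (L n) \<otimes>\<^bsub>H\<^esub> T n = T (n + 1) + vpow (- 1) *\<^sub>A T n"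
  "0 \<le> n \<Longrightarrow> n < int m \<Longrightarrow> cgen H (L n) \<otimes>\<^bsub>H\<^esub> T (n + 1) = vpow 1 *\<^sub>A T (n + 1) + T n"
  "n < 0 \<Longrightarrow> - int m \<le> n \<Longrightarrow> cgen H (L n) \<otimes>\<^bsub>H\<^esub> T (n + 1) = T n + vpow (- 1) *\<^sub>A T (n + 1)"
  "n < 0 \<Longrightarrow> - int m \<le> n \<Longrightarrow> cgen H (L n) \<otimes>\<^bsub>H\<^esub> T n = vpow 1 *\<^sub>A T n + T (n + 1)"
  using t_mult_D[of n] cgen_mult[OF L_in, of _ n]
  by (simp_all add: scal.scale_left_diff_distrib)

lemma cgen_b: "cgen H b = T 1 + vpow (- 1) *\<^sub>A T 0"
  using D_succ[of 0] gens by (simp add: cgen_def one_H letter_def)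

text \<open>Let \<open>u\<close> be the letter \<open>L j\<close>. Left multiplication by
  \<open>u\<close> pairs x with ux, and \<open>c_u\<close> acts on v^l(x) t_x + v^l(ux) t_ux as the
  scalar v + v^-1. Among the elements of length below \<open>j\<close> only \<open>D (1 - j)\<close>
  lacks its partner, which is \<open>D (- j)\<close>; its coefficient v^-1 produces the two
  correction terms.\<close>

lemma cgen_mult_lower_sum:
  "1 \<le> j \<Longrightarrow> j \<le> m \<Longrightarrow> cgen H (L (int j)) \<otimes>\<^bsub>H\<^esub> lower_sum W a b j =
    vpow (- 1) *\<^sub>A T (- int j) + (vpow 1 + vpow (- 1)) *\<^sub>A lower_sum W a b j - T (1 - int j)"
proof (induction j rule: less_induct)
  case (less j)
  \<comment> \<open>The letter depends on the parity of \<open>j\<close>, so the induction steps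
    from \<open>j - 2\<close> to \<open>j\<close> and needs two base cases.\<close>
  consider "j = 1" | "j = 2" | i where "j = Suc (Suc (Suc i))"
    using less.prems by (metis One_nat_def Suc_1 not0_implies_Suc not_one_le_zero)
  then show ?case
  proof cases
    case 1
    have "L 1 = L (- 1)" by (rule letter_cong) simp
    then have "cgen H (L 1) \<otimes>\<^bsub>H\<^esub> T 0 = T (- 1) + vpow (- 1) *\<^sub>A T 0"
      using cgen_mult_D(3)[of "- 1"] m_pos by simp
    then have "cgen H (L (int j)) \<otimes>\<^bsub>H\<^esub> lower_sum W a b j = vpow (- 1) *\<^sub>A (T (- 1) + vpow (- 1) *\<^sub>A T 0)"
      by (simp add: 1 del: altz_0)
    also have "\<dots> = vpow (- 1) *\<^sub>A T (- 1) + (vpow 1 + vpow (- 1)) *\<^sub>A vpow (- 1) *\<^sub>A T 0 - T 0"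
      by (rule poly_mapping_eqI) (simp add: lookup_add lookup_minus vpow_cancel algebra_simps del: altz_0)
    finally show ?thesis by (simp add: 1)
  next
    case 2
    have L: "L 2 = L 0" "L 0 = L (- 2)" by (rule letter_cong, simp)+
    have p: "cgen H (L 2) \<otimes>\<^bsub>H\<^esub> T 0 = T 1 + vpow (- 1) *\<^sub>A T 0"
      "cgen H (L 2) \<otimes>\<^bsub>H\<^esub> T 1 = vpow 1 *\<^sub>A T 1 + T 0"
      "cgen H (L 2) \<otimes>\<^bsub>H\<^esub> T (- 1) = T (- 2) + vpow (- 1) *\<^sub>A T (- 1)"
      using cgen_mult_D(1,2)[of 0] cgen_mult_D(3)[of "- 2"] less.prems 2 m_pos
      by (simp_all add: L)
    have S: "lower_sum W a b 2 = vpow (- 1) *\<^sub>A (vpow (- 1) *\<^sub>A T 0 + T 1 + T (- 1))"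
      by (simp add: numeral_2_eq_2)
    have "cgen H (L 2) \<otimes>\<^bsub>H\<^esub> lower_sum W a b 2 = vpow (- 1) *\<^sub>A (vpow (- 1) *\<^sub>A (T 1 + vpow (- 1) *\<^sub>A T 0)
        + (vpow 1 *\<^sub>A T 1 + T 0) + (T (- 2) + vpow (- 1) *\<^sub>A T (- 1)))"
      by (simp add: S p del: altz_0)
    also have "\<dots> = vpow (- 1) *\<^sub>A T (- 2) + (vpow 1 + vpow (- 1)) *\<^sub>A lower_sum W a b 2 - T (- 1)"
      unfolding S by (rule poly_mapping_eqI) (simp add: lookup_add lookup_minus vpow_cancel algebra_simps del: altz_0)
    finally show ?thesis by (simp add: 2)
  next
    case (3 i)
    define n where "n = int (Suc i)"
    have nm: "0 \<le> n" "n + 2 \<le> int m" using less.prems by (auto simp: n_def 3)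
    have j: "int j = n + 2" "- int j = - n - 2" "1 - int j = - n - 1"
      by (simp_all add: 3 n_def)
    let ?S = "lower_sum W a b (Suc i)" and ?u = "cgen H (L (n + 2))"
    have L: "L (n + 2) = L n" "L (n + 2) = L (- n)" "L (n + 2) = L (- n - 2)"
      by (rule letter_cong, simp)+
    have p: "?u \<otimes>\<^bsub>H\<^esub> T n = T (n + 1) + vpow (- 1) *\<^sub>A T n"
      "?u \<otimes>\<^bsub>H\<^esub> T (n + 1) = vpow 1 *\<^sub>A T (n + 1) + T n"
      using cgen_mult_D(1,2)[of n] nm by (simp_all only: L(1))
    have p': "?u \<otimes>\<^bsub>H\<^esub> T (- n) = vpow 1 *\<^sub>A T (- n) + T (1 - n)"
      using cgen_mult_D(4)[of "- n"] nm unfolding L(2) by (simp add: n_def add.commute)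
    have p'': "?u \<otimes>\<^bsub>H\<^esub> T (- n - 1) = T (- n - 2) + vpow (- 1) *\<^sub>A T (- n - 1)"
    proof -
      have e: "- n - 2 + 1 = - n - 1" by simp
      show ?thesis using cgen_mult_D(3)[of "- n - 2"] nm unfolding L(3) e by simp
    qed
    have IH: "?u \<otimes>\<^bsub>H\<^esub> ?S = vpow (- 1) *\<^sub>A T (- n) + (vpow 1 + vpow (- 1)) *\<^sub>A ?S - T (1 - n)"
      unfolding L(1) unfolding n_def by (rule less.IH) (use less.prems in \<open>auto simp: 3\<close>)
    have S: "lower_sum W a b j =
        vpow (- 1) *\<^sub>A (vpow (- 1) *\<^sub>A (?S + T n + T (- n)) + T (n + 1) + T (- n - 1))"
    proof -
      have e: "int (Suc i) = n" "int (Suc (Suc i)) = n + 1" "- (n + 1) = - n - 1"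
        by (simp_all add: n_def)
      show ?thesis by (simp only: 3 lower_sum.simps e)
    qed
    have "?u \<otimes>\<^bsub>H\<^esub> lower_sum W a b j = vpow (- 1) *\<^sub>A (vpow (- 1) *\<^sub>A
        ((vpow (- 1) *\<^sub>A T (- n) + (vpow 1 + vpow (- 1)) *\<^sub>A ?S - T (1 - n))
          + (T (n + 1) + vpow (- 1) *\<^sub>A T n) + (vpow 1 *\<^sub>A T (- n) + T (1 - n)))
        + (vpow 1 *\<^sub>A T (n + 1) + T n) + (T (- n - 2) + vpow (- 1) *\<^sub>A T (- n - 1)))"
      by (simp add: S p p' p'' IH)
    also have "\<dots> = vpow (- 1) *\<^sub>A T (- n - 2) + (vpow 1 + vpow (- 1)) *\<^sub>A lower_sum W a b j - T (- n - 1)"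
      unfolding S by (rule poly_mapping_eqI) (simp add: lookup_add lookup_minus vpow_cancel algebra_simps del: altz_0)
    finally show ?thesis unfolding j(2,3) unfolding j(1) .
  qed
qed

text \<open>Write S(j) for \<open>lower_sum W a b j\<close> and C(j) for \<open>T j\<close> + S(j).
  The correction terms of \<open>cgen_mult_lower_sum\<close> are absorbed by S(j+1) = v^-1 (S(j) +
  \<open>T j\<close> + \<open>T (- j)\<close>) and v S(j) = \<open>T (1 - j)\<close> + C(j-1). The
  case \<open>j = 1\<close> is separate because \<open>T 0\<close> + S(0) is the unit, while the
  recursion has 0 there.\<close>

lemma cgen_mult_kl:
  assumes "1 \<le> j" "j < m"
  shows "cgen H (L (int j)) \<otimes>\<^bsub>H\<^esub> (T (int j) + lower_sum W a b j) =
    (T (int j + 1) + lower_sum W a b (Suc j)) +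
    (if j = 1 then 0 else T (int j - 1) + lower_sum W a b (j - 1))"
proof -
  obtain i where i: "j = Suc i" using assms by (cases j) auto
  let ?S = "lower_sum W a b j"
  have S1: "lower_sum W a b (Suc j) = vpow (- 1) *\<^sub>A (?S + T (int j) + T (- int j))"
    using lower_sum.simps(3)[of W a b i, folded i] .
  have S0: "vpow 1 *\<^sub>A ?S = T (1 - int j) + (if j = 1 then 0 else T (int j - 1) + lower_sum W a b (j - 1))"
  proof (cases i)
    case 0
    then show ?thesis by (simp add: i vpow_inverse)
  next
    case (Suc n)
    have e: "1 - int j = - int (Suc n)" "int j - 1 = int (Suc n)" by (simp_all add: i Suc)
    show ?thesis unfolding e by (simp add: i Suc vpow_inverse scal.scale_right_distrib)
  qed
  have "cgen H (L (int j)) \<otimes>\<^bsub>H\<^esub> (T (int j) + ?S) = T (int j + 1) + vpow (- 1) *\<^sub>A T (int j)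
      + (vpow (- 1) *\<^sub>A T (- int j) + (vpow 1 + vpow (- 1)) *\<^sub>A ?S - T (1 - int j))"
    using cgen_mult_D(1)[of "int j"] cgen_mult_lower_sum[of j] assms
    by (simp del: altz_of_nat)
  also have "\<dots> = (T (int j + 1) + lower_sum W a b (Suc j)) + (vpow 1 *\<^sub>A ?S - T (1 - int j))"
    unfolding S1 by (simp add: algebra_simps)
  finally show ?thesis unfolding S0 by simp
qed

lemma t_square:
  assumes "u \<in> {a, b}"
  shows "tbasis u \<otimes>\<^bsub>H\<^esub> tbasis u = (vpow 1 - vpow (- 1)) *\<^sub>A tbasis u + \<one>\<^bsub>H\<^esub>"
proof -
  have "D 1 = b" "D (- 1) = a" "L 0 = b" "L (- 1) = a"
    using D_succ[of 0] D_pred[of 0] gens by (simp_all add: letter_def)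
  then show ?thesis
    using assms t_mult_D(2)[of 0] t_mult_D(4)[of "- 1"] m_pos by (auto simp: one_H)
qed

lemma cgen_square:
  assumes "u \<in> {a, b}"
  shows "cgen H u \<otimes>\<^bsub>H\<^esub> cgen H u = (vpow 1 + vpow (- 1)) *\<^sub>A cgen H u"
proof -
  have "tbasis u \<in> carrier H" using assms gens by auto
  then have "cgen H u \<otimes>\<^bsub>H\<^esub> cgen H u = ((vpow 1 - vpow (- 1)) *\<^sub>A tbasis u + \<one>\<^bsub>H\<^esub>)
      + vpow (- 1) *\<^sub>A tbasis u + vpow (- 1) *\<^sub>A (tbasis u + vpow (- 1) *\<^sub>A \<one>\<^bsub>H\<^esub>)"
    by (simp add: cgen_def t_square[OF assms])
  also have "\<dots> = (vpow 1 + vpow (- 1)) *\<^sub>A cgen H u"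
    unfolding cgen_def by (rule poly_mapping_eqI) (simp add: lookup_add vpow_cancel algebra_simps)
  finally show ?thesis .
qed

lemma cgen_cgen:
  assumes "f \<in> carrier H"
  shows "cgen H (L n) \<otimes>\<^bsub>H\<^esub> (cgen H (L n) \<otimes>\<^bsub>H\<^esub> f) = (vpow 1 + vpow (- 1)) *\<^sub>A (cgen H (L n) \<otimes>\<^bsub>H\<^esub> f)"
  using assms by (simp flip: H.m_assoc add: cgen_square[OF L_in])

end

section \<open>The Kazhdan-Lusztig basis\<close>

fun cheb :: "('a hecke) ring \<Rightarrow> 'a \<Rightarrow> 'a \<Rightarrow> nat \<Rightarrow> 'a hecke" where
  "cheb H a b 0 = 0"
| "cheb H a b (Suc 0) = cgen H b"
| "cheb H a b (Suc (Suc n)) =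
     cgen H (letter a b (int (Suc n))) \<otimes>\<^bsub>H\<^esub> cheb H a b (Suc n) - cheb H a b n"

section \<open>Chebyshev elements up to, at and beyond the longest element\<close>

context dihedral_hecke
begin

abbreviation q where "q \<equiv> vpow 1 + vpow (- 1)"

lemma cheb_closed [simp]: "cheb H a b j \<in> carrier H"
  by (induction j rule: induct_nat_012) simp_all

lemma cheb_rec: "1 \<le> j \<Longrightarrow>
    cgen H (L (int j)) \<otimes>\<^bsub>H\<^esub> cheb H a b j = cheb H a b (Suc j) + cheb H a b (j - 1)"
  by (cases j) (simp_all del: of_nat_Suc)

text \<open>By \<open>cgen_mult_kl\<close> the explicit sums obey the defining recursion as long as
  the index does not exceed \<open>m\<close>.\<close>

lemma cheb_eq: "1 \<le> j \<Longrightarrow> j \<le> m \<Longrightarrow> cheb H a b j = T (int j) + lower_sum W a b j"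
proof (induction j rule: induct_nat_012)
  case 1
  show ?case by (simp add: cgen_b del: altz_0 alternating.simps(2) altz_of_nat)
next
  case (ge2 n)
  let ?R = "if Suc n = 1 then 0 else T (int (Suc n) - 1) + lower_sum W a b (Suc n - 1)"
  have "cheb H a b (Suc (Suc n)) = cgen H (L (int (Suc n))) \<otimes>\<^bsub>H\<^esub> cheb H a b (Suc n) - cheb H a b n"
    by simp
  also have "cheb H a b (Suc n) = T (int (Suc n)) + lower_sum W a b (Suc n)"
    using ge2 by simp
  also have "cgen H (L (int (Suc n))) \<otimes>\<^bsub>H\<^esub> \<dots> = T (int (Suc n) + 1) + lower_sum W a b (Suc (Suc n)) + ?R"
    by (rule cgen_mult_kl) (use ge2.prems in auto)
  also have "?R = cheb H a b n"
    using ge2 by (cases n) (simp_all del: altz_of_nat)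
  finally show ?case by (simp add: add.commute del: altz_of_nat lower_sum.simps cheb.simps)
qed simp

text \<open>For \<open>j \<ge> 1\<close> this letter u is the first letter of the word with index
  \<open>j\<close>. For \<open>j \<ge> 2\<close> it is also the letter in C(j) = \<open>c_u\<close>
  C(j-1) - C(j-2); the relation \<open>c_u^2 = (v + v^-1) c_u\<close> settles the first term and
  induction the second.\<close>

lemma cheb_descent:
  "cgen H (L (int j - 1)) \<otimes>\<^bsub>H\<^esub> cheb H a b j = q *\<^sub>A cheb H a b j"
proof (induction j rule: induct_nat_012)
  case 1
  show ?case by (simp add: letter_def cgen_square)
next
  case (ge2 n)
  have L: "L (int (Suc (Suc n)) - 1) = L (int (Suc n))" "L (int n - 1) = L (int (Suc n))"
    by (rule letter_cong, simp)+
  show ?case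
    using ge2.IH(1) unfolding L cheb.simps
    by (simp add: cgen_cgen scal.scale_right_diff_distrib del: of_nat_Suc)
qed simp

text \<open>At index \<open>m\<close> the two words coincide by \<open>D_m\<close>, and lower sums
  are symmetric in the generators.\<close>

lemma cheb_longest: "cheb H b a m = cheb H a b m"
proof -
  interpret swap: dihedral_hecke W b a m H by (rule swap)
  show ?thesis
    using cheb_eq[of m] swap.cheb_eq[of m] m_pos D_m altz_swap[of W b a "int m"]
    by (simp add: lower_sum_swap[of W b a])
qed

text \<open>Each generator is the first letter of one of the two words for the longest element, so
  \<open>cheb_descent\<close> applies in one of the two orders.\<close>

lemma cgen_mult_longest: "cgen H (L n) \<otimes>\<^bsub>H\<^esub> cheb H a b m = q *\<^sub>A cheb H a b m"
proof -
  interpret swap: dihedral_hecke W b a m H by (rule swap)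
  have "L n = L (int m - 1) \<or> L n = letter b a (int m - 1)" by (auto simp: letter_def)
  then show ?thesis
    using cheb_descent[of m] swap.cheb_descent[of m] cheb_longest by metis
qed

text \<open>The scalars v^d + v^-d satisfy the same recursion in \<open>d\<close> as the elements on
  both sides of index \<open>m\<close>, with v + v^-1 as the multiplier provided by
  \<open>cgen_mult_longest\<close>.\<close>

lemma cheb_above:
  "d \<le> m \<Longrightarrow> cheb H a b (m + d) = (vpow (int d) + vpow (- int d)) *\<^sub>A cheb H a b m - cheb H a b (m - d)"
proof (induction d rule: induct_nat_012)
  case 0
  show ?case using scal.scale_left_distrib[of 1 1 "cheb H a b m"] by simp
next
  case 1
  have "cheb H a b (Suc m) = cgen H (L (int m)) \<otimes>\<^bsub>H\<^esub> cheb H a b m - cheb H a b (m - 1)"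
    using cheb_rec[of m] m_pos by simp
  then show ?case by (simp add: cgen_mult_longest)
next
  case (ge2 n)
  define d where "d = Suc n"
  have d: "1 \<le> d" "Suc d \<le> m" using ge2.prems by (auto simp: d_def)
  \<comment> \<open>The indices \<open>m + d\<close> and \<open>m - d\<close> have equal parity, so
    one letter drives the recursion at both places, upwards at the first and downwards at the
    second.\<close>
  have "L (int (m + d)) = L (int (m - d))" by (rule letter_cong) (use d in auto)
  then have "cgen H (L (int (m + d))) \<otimes>\<^bsub>H\<^esub> cheb H a b (m - d) = cheb H a b (m - n) + cheb H a b (m - Suc d)"
    using cheb_rec[of "m - d"] d by (simp add: d_def Suc_diff_Suc)
  moreover have "cheb H a b (m + d) = (vpow (int d) + vpow (- int d)) *\<^sub>A cheb H a b m - cheb H a b (m - d)"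
    using ge2 by (simp add: d_def)
  ultimately have "cgen H (L (int (m + d))) \<otimes>\<^bsub>H\<^esub> cheb H a b (m + d) =
      (vpow (int d) + vpow (- int d)) *\<^sub>A q *\<^sub>A cheb H a b m - (cheb H a b (m - n) + cheb H a b (m - Suc d))"
    by (simp add: cgen_mult_longest)
  moreover have "cheb H a b (m + n) = (vpow (int n) + vpow (- int n)) *\<^sub>A cheb H a b m - cheb H a b (m - n)"
    using ge2 by simp
  moreover have "cheb H a b (m + Suc d) =
      cgen H (L (int (m + d))) \<otimes>\<^bsub>H\<^esub> cheb H a b (m + d) - cheb H a b (m + n)"
    using cheb_rec[of "m + d"] d by (simp add: d_def)
  moreover have "(vpow (int d) + vpow (- int d)) * q =
      (vpow (int (Suc d)) + vpow (- int (Suc d))) + (vpow (int n) + vpow (- int n))"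
    by (simp add: d_def distrib_left distrib_right vpow_add)
  then have "(vpow (int d) + vpow (- int d)) *\<^sub>A q *\<^sub>A cheb H a b m =
      (vpow (int (Suc d)) + vpow (- int (Suc d))) *\<^sub>A cheb H a b m
      + (vpow (int n) + vpow (- int n)) *\<^sub>A cheb H a b m"
    by (simp only: scal.scale_scale flip: scal.scale_left_distrib)
  ultimately have "cheb H a b (m + Suc d) =
      (vpow (int (Suc d)) + vpow (- int (Suc d))) *\<^sub>A cheb H a b m - cheb H a b (m - Suc d)"
    by (simp only:) simp
  then show ?case by (simp only: d_def)
qed

end

section \<open>The involution\<close>

locale dihedral_kl = dihedral_hecke W a b m H
  for W :: "('a, 'e) monoid_scheme" (structure) and a b m and H :: "'a hecke ring" +
  fixes \<iota> :: "'a hecke \<Rightarrow> 'a hecke" and c :: "'a \<Rightarrow> 'a hecke"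
  assumes involution: "hecke_involution W H \<iota>" and kl: "kl_basis W {a, b} \<iota> c"
begin

lemma swap_kl: "dihedral_kl W b a m H \<iota> c"
  using swap involution kl
  by (simp add: dihedral_kl_def dihedral_kl_axioms_def insert_commute)

lemma iota_hom: "\<iota> \<in> ring_hom H H"
  using involution by (simp add: hecke_involution_def)

lemma iota_closed [simp]: "f \<in> carrier H \<Longrightarrow> \<iota> f \<in> carrier H"
  using ring_hom_closed[OF iota_hom] .

lemma iota_add [simp]: "f \<in> carrier H \<Longrightarrow> g \<in> carrier H \<Longrightarrow> \<iota> (f + g) = \<iota> f + \<iota> g"
  using ring_hom_add[OF iota_hom, of f g] by (simp add: add_H)

lemma iota_diff [simp]: "f \<in> carrier H \<Longrightarrow> g \<in> carrier H \<Longrightarrow> \<iota> (f - g) = \<iota> f - \<iota> g"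
  using iota_add[of "f - g" g] by (simp del: iota_add)

lemma iota_zero [simp]: "\<iota> 0 = 0"
  using iota_diff[of 0 0] by simp

lemma iota_mult: "f \<in> carrier H \<Longrightarrow> g \<in> carrier H \<Longrightarrow> \<iota> (f \<otimes>\<^bsub>H\<^esub> g) = \<iota> f \<otimes>\<^bsub>H\<^esub> \<iota> g"
  using ring_hom_mult[OF iota_hom] .

lemma iota_one: "\<iota> \<one>\<^bsub>H\<^esub> = \<one>\<^bsub>H\<^esub>"
  using ring_hom_one[OF iota_hom] .

lemma iota_sum: "(\<And>x. x \<in> Y \<Longrightarrow> f x \<in> carrier H) \<Longrightarrow> \<iota> (\<Sum>x\<in>Y. f x) = (\<Sum>x\<in>Y. \<iota> (f x))"
  by (induction Y rule: infinite_finite_induct) (auto simp: sum_closed)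

lemma iota_vpow_nat: "\<iota> (vpow (int j) *\<^sub>A \<one>\<^bsub>H\<^esub>) = vpow (- int j) *\<^sub>A \<one>\<^bsub>H\<^esub>"
proof (induction j)
  case 0
  show ?case by (simp add: iota_one)
next
  case (Suc j)
  have "vpow (int (Suc j)) *\<^sub>A \<one>\<^bsub>H\<^esub> = (vpow 1 *\<^sub>A \<one>\<^bsub>H\<^esub>) \<otimes>\<^bsub>H\<^esub> (vpow (int j) *\<^sub>A \<one>\<^bsub>H\<^esub>)"
    by (simp add: vpow_add add.commute)
  then have "\<iota> (vpow (int (Suc j)) *\<^sub>A \<one>\<^bsub>H\<^esub>) =
      \<iota> (vpow 1 *\<^sub>A \<one>\<^bsub>H\<^esub>) \<otimes>\<^bsub>H\<^esub> \<iota> (vpow (int j) *\<^sub>A \<one>\<^bsub>H\<^esub>)"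
    by (simp only: iota_mult H.one_closed scal_closed)
  also have "\<dots> = (vpow (- 1) *\<^sub>A \<one>\<^bsub>H\<^esub>) \<otimes>\<^bsub>H\<^esub> (vpow (- int j) *\<^sub>A \<one>\<^bsub>H\<^esub>)"
    using involution Suc by (simp only: hecke_involution_def)
  finally have "\<iota> (vpow (int (Suc j)) *\<^sub>A \<one>\<^bsub>H\<^esub>) = vpow (- int j - 1) *\<^sub>A \<one>\<^bsub>H\<^esub>"
    by (simp add: vpow_add)
  also have "- int j - 1 = - int (Suc j)" by simp
  finally show ?case .
qed

text \<open>The involution is prescribed on \<open>v\<close> only. Multiplicativity gives the
  nonnegative powers, self-inverseness the negative ones, and additivity the integer combinations, a
  Laurent polynomial being an element of the free abelian group on the exponents.\<close>

lemma iota_scal_one: "\<iota> (p *\<^sub>A \<one>\<^bsub>H\<^esub>) = bar p *\<^sub>A \<one>\<^bsub>H\<^esub>"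
proof -
  have "Poly_Mapping.keys p \<subseteq> UNIV" by simp
  then show ?thesis
  proof (induction p rule: frag_induction)
    case (one n)
    have "\<iota> (vpow n *\<^sub>A \<one>\<^bsub>H\<^esub>) = vpow (- n) *\<^sub>A \<one>\<^bsub>H\<^esub>"
    proof (cases "n \<ge> 0")
      case True
      then show ?thesis using iota_vpow_nat[of "nat n"] by simp
    next
      case False
      then have "vpow n *\<^sub>A \<one>\<^bsub>H\<^esub> = \<iota> (vpow (- n) *\<^sub>A \<one>\<^bsub>H\<^esub>)"
        using iota_vpow_nat[of "nat (- n)"] by simp
      then show ?thesis using involution by (simp add: hecke_involution_def)
    qed
    moreover have "frag_of n = vpow n" by (simp add: vpow_def)
    ultimately show ?case by simp
  next
    case (diff p p')
    then show ?case by (simp add: bar_diff scal.scale_left_diff_distrib)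
  qed simp
qed

lemma iota_scal [simp]: "f \<in> carrier H \<Longrightarrow> \<iota> (p *\<^sub>A f) = bar p *\<^sub>A \<iota> f"
  using iota_mult[of "p *\<^sub>A \<one>\<^bsub>H\<^esub>" f] by (simp add: iota_scal_one)

text \<open>The quadratic relation gives t_u - (v - v^-1) as the inverse of t_u. Adding v, the image
  of v^-1, restores t_u + v^-1.\<close>

lemma iota_cgen:
  assumes "u \<in> {a, b}"
  shows "\<iota> (cgen H u) = cgen H u"
proof -
  have u: "u \<in> carrier W" "inv u = u" using assms gens inv_equality by auto
  let ?y = "tbasis u - (vpow 1 - vpow (- 1)) *\<^sub>A \<one>\<^bsub>H\<^esub>"
  have "inv\<^bsub>H\<^esub> (tbasis u) = ?y"
    by (rule H.inv_char) (use u t_square[OF assms] in simp_all)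
  then have "\<iota> (tbasis u) = ?y"
    using involution u by (simp add: hecke_involution_def)
  then show ?thesis
    using u by (simp add: cgen_def iota_one scal.scale_left_diff_distrib)
qed

lemma iota_cheb: "\<iota> (cheb H a b j) = cheb H a b j"
  by (induction j rule: induct_nat_012) (simp_all add: iota_cgen iota_cgen[OF L_in] iota_mult del: of_nat_Suc)

end

lemma keys_add_subset: "Poly_Mapping.keys f \<subseteq> Y \<Longrightarrow> Poly_Mapping.keys g \<subseteq> Y \<Longrightarrow> Poly_Mapping.keys (f + g) \<subseteq> Y"
  using keys_add[of f g] by auto

lemma keys_diff_subset: "Poly_Mapping.keys f \<subseteq> Y \<Longrightarrow> Poly_Mapping.keys g \<subseteq> Y \<Longrightarrow> Poly_Mapping.keys (f - g) \<subseteq> Y"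
  using keys_diff[of f g] by auto

lemma keys_scal_subset: "Poly_Mapping.keys f \<subseteq> Y \<Longrightarrow> Poly_Mapping.keys (p *\<^sub>A f) \<subseteq> Y"
  using keys_scal[of p f] by auto

lemma keys_tbasis_subset: "x \<in> Y \<Longrightarrow> Poly_Mapping.keys (tbasis x) \<subseteq> Y"
  by (simp add: tbasis_def)

lemmas keys_subset_intros =
  keys_add_subset keys_diff_subset keys_scal_subset keys_tbasis_subset

section \<open>Triangularity and uniqueness of the Kazhdan-Lusztig basis\<close>

context dihedral_hecke
begin

lemma keys_lower_sum: "j \<le> m \<Longrightarrow> Poly_Mapping.keys (lower_sum W a b j) \<subseteq> {x. len x < j}"
proof (induction j rule: induct_nat_012)
  case 1
  then show ?case using len_D[of 0] by (auto intro!: keys_subset_intros)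
next
  case (ge2 n)
  then have "Poly_Mapping.keys (lower_sum W a b (Suc n)) \<subseteq> {x. len x < Suc (Suc n)}" by force
  then show ?case
    using ge2.prems len_D[of "int (Suc n)"] len_D[of "- int (Suc n)"]
    unfolding lower_sum.simps
    by (intro keys_subset_intros) (simp_all del: altz_of_nat of_nat_Suc)
qed simp

lemma lower_sum_neg: "Poly_Mapping.lookup (lower_sum W a b j) x \<in> neg_laurent"
proof (induction j rule: induct_nat_012)
  case 1
  then show ?case by (simp add: lookup_tbasis neg_laurent_0 neg_laurent_vpow)
next
  case (ge2 n)
  have "vpow (- 1) * Poly_Mapping.lookup (tbasis y) x \<in> neg_laurent" for y
    by (simp add: lookup_tbasis neg_laurent_0 neg_laurent_vpow)
  then show ?case
    unfolding lower_sum.simps lookup_scal lookup_add distrib_left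
    by (intro neg_laurent_add neg_laurent_mult[OF neg_laurent_vpow ge2.IH(2)])
qed (simp add: neg_laurent_0)

end

context dihedral_kl
begin

text \<open>A rearrangement of the invariance of the Chebyshev elements, for both orders of the
  generators. It describes \<open>\<iota>\<close> on the standard basis without computing inverses
  of long words.\<close>

lemma iota_T:
  assumes "1 \<le> j" "j \<le> m"
  shows "\<iota> (T (int j)) = T (int j) + lower_sum W a b j - \<iota> (lower_sum W a b j)"
    and "\<iota> (T (- int j)) = T (- int j) + lower_sum W a b j - \<iota> (lower_sum W a b j)"
proof -
  interpret swap: dihedral_kl W b a m H \<iota> c by (rule swap_kl)
  show "\<iota> (T (int j)) = T (int j) + lower_sum W a b j - \<iota> (lower_sum W a b j)"
    using iota_cheb[of j] cheb_eq[of j] assms by (simp add: eq_diff_eq del: altz_of_nat)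
  show "\<iota> (T (- int j)) = T (- int j) + lower_sum W a b j - \<iota> (lower_sum W a b j)"
    using swap.iota_cheb[of j] swap.cheb_eq[of j] assms
    by (simp add: eq_diff_eq lower_sum_swap[of W b a] altz_swap[of W b a] del: altz_of_nat)
qed

lemma keys_iota_lower_sum: "j \<le> m \<Longrightarrow> Poly_Mapping.keys (\<iota> (lower_sum W a b j)) \<subseteq> {x. len x < j}"
proof (induction j rule: induct_nat_012)
  case 1
  then show ?case using len_D[of 0] iota_one one_H
    by (auto intro!: keys_subset_intros)
next
  case (ge2 n)
  then have "Poly_Mapping.keys (\<iota> (lower_sum W a b (Suc n))) \<subseteq> {x. len x < Suc (Suc n)}"
    "Poly_Mapping.keys (lower_sum W a b (Suc n)) \<subseteq> {x. len x < Suc (Suc n)}"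
    using keys_lower_sum[of "Suc n"] by force+
  moreover have "\<iota> (lower_sum W a b (Suc (Suc n))) = vpow 1 *\<^sub>A (\<iota> (lower_sum W a b (Suc n)) +
      \<iota> (T (int (Suc n))) + \<iota> (T (- int (Suc n))))"
    by (simp del: altz_of_nat of_nat_Suc)
  moreover have "len (D (int (Suc n))) = Suc n" "len (D (- int (Suc n))) = Suc n"
    using ge2.prems len_D[of "int (Suc n)"] len_D[of "- int (Suc n)"]
    by (simp_all del: altz_of_nat of_nat_Suc)
  moreover have "1 \<le> Suc n" "Suc n \<le> m" using ge2.prems by auto
  ultimately show ?case
    by (simp only: iota_T[of "Suc n"])
      (intro keys_subset_intros, simp_all del: altz_of_nat of_nat_Suc)
qed simp

lemma iota_tbasis_triangular:
  assumes "x \<in> carrier W"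
  shows "Poly_Mapping.keys (\<iota> (tbasis x) - tbasis x) \<subseteq> {y. len y < len x}"
proof -
  obtain n where n: "x = D n" "\<bar>n\<bar> \<le> int m" using assms D_range by blast
  show ?thesis
  proof (cases "n = 0")
    case True
    then show ?thesis using n iota_one one_H by simp
  next
    case False
    define j where "j = nat \<bar>n\<bar>"
    have j: "1 \<le> j" "j \<le> m" "n = int j \<or> n = - int j" "len x = j"
      using n False len_D by (auto simp: j_def)
    then have "\<iota> (tbasis x) - tbasis x = lower_sum W a b j - \<iota> (lower_sum W a b j)"
      using iota_T[of j] n by (auto simp del: altz_of_nat)
    then show ?thesis
      using keys_diff_subset[OF keys_lower_sum[of j] keys_iota_lower_sum[of j]] j by simp
  qed
qed

text \<open>At a longest element of the support, triangularity makes the coefficient invariant under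
  \<open>bar\<close>. Since it lies in v^-1 Z[v^-1], it vanishes, a contradiction.\<close>

lemma iota_fixed_neg_zero:
  assumes "f \<in> carrier H" "\<iota> f = f" "\<And>x. Poly_Mapping.lookup f x \<in> neg_laurent"
  shows "f = 0"
proof (rule ccontr)
  assume "f \<noteq> 0"
  let ?K = "Poly_Mapping.keys f"
  have K: "finite ?K" "?K \<noteq> {}" "?K \<subseteq> carrier W" using \<open>f \<noteq> 0\<close> assms(1) by (auto simp: carrier_H)
  obtain x where x: "x \<in> ?K" "\<And>y. y \<in> ?K \<Longrightarrow> len y \<le> len x"
  proof -
    have "Max (len ` ?K) \<in> len ` ?K" using K by simp
    then obtain x where "x \<in> ?K" "Max (len ` ?K) = len x" by auto
    then show thesis using that[of x] K by (metis Max_ge finite_imageI imageI)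
  qed
  have "\<iota> f = \<iota> (\<Sum>y\<in>?K. Poly_Mapping.lookup f y *\<^sub>A tbasis y)"
    using poly_mapping_eq_sum_tbasis[of f] by simp
  also have "\<dots> = (\<Sum>y\<in>?K. bar (Poly_Mapping.lookup f y) *\<^sub>A \<iota> (tbasis y))"
    using K(3) by (subst iota_sum) (auto intro!: sum.cong)
  finally have "Poly_Mapping.lookup (\<iota> f) x =
      (\<Sum>y\<in>?K. bar (Poly_Mapping.lookup f y) * Poly_Mapping.lookup (\<iota> (tbasis y)) x)"
    by (simp add: lookup_sum)
  also have "\<dots> = (\<Sum>y\<in>?K. if y = x then bar (Poly_Mapping.lookup f x) else 0)"
  proof (rule sum.cong)
    fix y assume y: "y \<in> ?K"
    then have "x \<notin> Poly_Mapping.keys (\<iota> (tbasis y) - tbasis y)"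
      using iota_tbasis_triangular[of y] x(2)[OF y] K(3) by force
    then have "Poly_Mapping.lookup (\<iota> (tbasis y)) x = (if y = x then 1 else 0)"
      by (simp add: in_keys_iff lookup_minus lookup_tbasis)
    then show "bar (Poly_Mapping.lookup f y) * Poly_Mapping.lookup (\<iota> (tbasis y)) x =
        (if y = x then bar (Poly_Mapping.lookup f x) else 0)" by simp
  qed simp
  also have "\<dots> = bar (Poly_Mapping.lookup f x)" using K x by simp
  finally have "Poly_Mapping.lookup f x = 0"
    using neg_laurent_bar_fixed assms by simp
  then show False using x by (simp add: in_keys_iff)
qed

text \<open>Both elements are fixed by \<open>\<iota>\<close>. In their difference the leading term
  cancels and the other coefficients lie in v^-1 Z[v^-1], so \<open>iota_fixed_neg_zero\<close>
  applies.\<close>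

lemma kl_eq_cheb:
  assumes "1 \<le> j" "j \<le> m"
  shows "c (alternating W j a b) = cheb H a b j"
proof -
  let ?y = "alternating W j a b"
  obtain p where p: "\<And>x. p x \<in> neg_laurent" "\<iota> (c ?y) = c ?y"
      "c ?y = tbasis ?y + (\<Sum>x | bruhat_less W {a, b} x ?y. p x *\<^sub>A tbasis x)"
    using kl unfolding kl_basis_def by (meson alternating_closed(1))
  have x: "x \<in> carrier W" if "bruhat_less W {a, b} x ?y" for x
    using that unfolding bruhat_less_def by (auto dest: tranclpD)
  have cl: "c ?y \<in> carrier H"
    unfolding p(3) using x by (auto intro!: add_closed sum_closed)
  have "c ?y - cheb H a b j = 0"
  proof (rule iota_fixed_neg_zero)
    show "\<iota> (c ?y - cheb H a b j) = c ?y - cheb H a b j"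
      using cl p(2) iota_cheb by simp
    fix z
    have "Poly_Mapping.lookup (c ?y - cheb H a b j) z =
        (\<Sum>x | bruhat_less W {a, b} x ?y. p x * Poly_Mapping.lookup (tbasis x) z)
        - Poly_Mapping.lookup (lower_sum W a b j) z"
      unfolding p(3) cheb_eq[OF assms] by (simp add: lookup_minus lookup_add lookup_sum)
    moreover have "(\<Sum>x\<in>Y. p x * Poly_Mapping.lookup (tbasis x) z) \<in> neg_laurent" for Y
      by (induction Y rule: infinite_finite_induct)
        (auto simp: neg_laurent_0 lookup_tbasis p(1) intro!: neg_laurent_add)
    ultimately show "Poly_Mapping.lookup (c ?y - cheb H a b j) z \<in> neg_laurent"
      using lower_sum_neg neg_laurent_diff by simp
  qed (use cl in simp)
  then show ?thesis by simp
qed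

end

section \<open>Formal combinations\<close>

lemma eval_formal_superset:
  assumes "finite Y" "Poly_Mapping.keys f \<subseteq> Y"
  shows "eval_formal C f = (\<Sum>j\<in>Y. Poly_Mapping.lookup f j *\<^sub>A C j)"
  unfolding eval_formal_def
  by (rule sum.mono_neutral_left) (use assms in \<open>auto simp: in_keys_iff\<close>)

lemma eval_formal_add: "eval_formal C (f + g) = eval_formal C f + eval_formal C g"
proof -
  let ?Y = "Poly_Mapping.keys f \<union> Poly_Mapping.keys g"
  have "eval_formal C h = (\<Sum>j\<in>?Y. Poly_Mapping.lookup h j *\<^sub>A C j)" if "h \<in> {f, g, f + g}" for h
    using that keys_add[of f g] by (intro eval_formal_superset) auto
  then show ?thesis by (simp add: lookup_add scal.scale_left_distrib sum.distrib)
qed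

lemma eval_formal_scal: "eval_formal C (p *\<^sub>A f) = p *\<^sub>A eval_formal C f"
  using eval_formal_superset[OF _ keys_scal[of p f], of C]
  by (simp add: eval_formal_def scal.scale_sum_right)

lemma replace_pairs_add: "replace_pairs m (f + g) = replace_pairs m f + replace_pairs m g"
  by (simp add: replace_pairs_def lookup_add scal.scale_left_distrib sum.distrib)

lemma replace_pairs_scal: "replace_pairs m (p *\<^sub>A f) = p *\<^sub>A replace_pairs m f"
  by (simp add: replace_pairs_def scal.scale_right_distrib scal.scale_sum_right)

text \<open>Replacement followed by evaluation is linear, so it is determined by its values on the
  single symbols \<open>Csym j\<close>.\<close>

definition eval_replaced :: "(nat \<Rightarrow> 'a hecke) \<Rightarrow> nat \<Rightarrow> formal \<Rightarrow> 'a hecke" where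
  "eval_replaced C m f = eval_formal C (replace_pairs m f)"

lemma eval_replaced_add: "eval_replaced C m (f + g) = eval_replaced C m f + eval_replaced C m g"
  by (simp add: eval_replaced_def replace_pairs_add eval_formal_add)

lemma eval_replaced_scal: "eval_replaced C m (p *\<^sub>A f) = p *\<^sub>A eval_replaced C m f"
  by (simp add: eval_replaced_def replace_pairs_scal eval_formal_scal)

lemma eval_replaced_sum: "eval_replaced C m (\<Sum>x\<in>Y. f x) = (\<Sum>x\<in>Y. eval_replaced C m (f x))"
proof (induction Y rule: infinite_finite_induct)
  case (insert x Y)
  then show ?case by (simp add: eval_replaced_add)
\<comment> \<open>Scaling by 0 supplies the value at the zero combination, for empty and infinite
  index sets.\<close>
qed (use eval_replaced_scal[of C m 0 0] in simp_all)

lemma eval_formal_Csym: "eval_formal C (Csym j) = (if j = 0 then 0 else C j)"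
  by (simp add: eval_formal_def Csym_def)

lemma eval_formal_diff: "eval_formal C (f - g) = eval_formal C f - eval_formal C g"
  using eval_formal_add[of C "f - g" g] by simp

lemma replace_pairs_Csym_le: "j \<le> m \<Longrightarrow> replace_pairs m (Csym j) = Csym j"
  by (auto simp: replace_pairs_def lookup_Csym intro!: sum.neutral)

lemma replace_pairs_Csym_above:
  assumes "1 \<le> d" "d \<le> m"
  shows "replace_pairs m (Csym (m + d)) =
    (vpow (int d) + vpow (- int d)) *\<^sub>A Csym m - Csym (m - d)"
proof -
  let ?t = "\<lambda>d'. (vpow (int d') + vpow (- int d')) *\<^sub>A Csym m - (Csym (m + d') + Csym (m - d'))"
  have "replace_pairs m (Csym (m + d)) = Csym (m + d) + (\<Sum>d'=1..m. if d' = d then ?t d else 0)"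
    unfolding replace_pairs_def
    by (intro arg_cong2[where f = "(+)"] sum.cong refl) (use assms in \<open>auto simp: lookup_Csym\<close>)
  then show ?thesis using assms by simp
qed

section \<open>Ladders of an odd function\<close>

text \<open>The arguments run from \<open>1 - d\<close> to \<open>d - 1\<close> and are symmetric
  about 0. The two end terms cancel, leaving the sum for \<open>d - 2\<close>.\<close>

lemma odd_sum_zero:
  fixes g :: "int \<Rightarrow> 'b :: ab_group_add"
  assumes "\<And>n. g (- n) = - g n" "g 0 = 0"
  shows "(\<Sum>r<d. g (1 - int d + 2 * int r)) = 0"
proof (induction d rule: induct_nat_012)
  case (ge2 n)
  have "(\<Sum>r<Suc (Suc n). g (1 - int (Suc (Suc n)) + 2 * int r)) =
      g (- (int n + 1)) + (\<Sum>r<n. g (1 - int n + 2 * int r)) + g (int n + 1)"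
    by (subst sum.lessThan_Suc_shift, subst sum.lessThan_Suc) (simp add: algebra_simps)
  then show ?case using ge2 assms(1)[of "int n + 1"] by simp
qed (use assms in simp_all)

text \<open>On the left stand \<open>i\<close> terms centred at \<open>k\<close>. The first
  \<open>i - k\<close> of them are symmetric about 0 and cancel; the remaining \<open>k\<close>
  terms are centred at \<open>i\<close>.\<close>

lemma ladder_swap:
  fixes g :: "int \<Rightarrow> 'b :: ab_group_add"
  assumes "\<And>n. g (- n) = - g n" "g 0 = 0" "k \<le> i"
  shows "(\<Sum>r<i. g (int k - int i + 1 + 2 * int r)) = (\<Sum>r<k. g (int i - int k + 1 + 2 * int r))"
proof -
  define d where "d = i - k"
  have i: "i = d + k" using assms(3) by (simp add: d_def)
  have "(\<Sum>r<i. g (int k - int i + 1 + 2 * int r)) =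
      (\<Sum>r<d. g (1 - int d + 2 * int r)) + (\<Sum>r<k. g (1 - int d + 2 * int (d + r)))"
    unfolding i lessThan_atLeast0 sum.atLeastLessThan_concat[of 0 d "d + k", symmetric, OF le0 le_add1]
      sum.shift_bounds_nat_ivl[of _ 0 d k, simplified add_0 add.commute[of k d]]
    by (simp add: algebra_simps)
  then show ?thesis
    using odd_sum_zero[of g d] assms by (simp add: i algebra_simps)
qed

text \<open>Inner terms occur in two neighbouring pairs, end terms in one: the coefficient pattern
  1, 2, ..., 2, 1 of \<open>formF\<close>.\<close>

lemma double_ladder:
  fixes h :: "nat \<Rightarrow> 'b \<Rightarrow>\<^sub>0 laurent"
  assumes "0 < i"
  shows "(\<Sum>r<i. h (Suc r) + h r) = h 0 + (\<Sum>r=1..<i. 2 *\<^sub>A h r) + h i"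
proof -
  have two: "2 *\<^sub>A f = f + f" for f :: "'b \<Rightarrow>\<^sub>0 laurent"
    using scal.scale_left_distrib[of 1 1 f] by simp
  show ?thesis using assms
    by (induction i rule: nat_induct_non_zero) (simp_all add: two algebra_simps)
qed

section \<open>Products as ladders of integer-indexed Chebyshev elements\<close>

context dihedral_hecke
begin

definition chebz :: "int \<Rightarrow> 'a hecke" where
  "chebz n = (if n \<ge> 0 then cheb H a b (nat n) else - cheb H a b (nat (- n)))"

lemma chebz_of_nat: "chebz (int j) = cheb H a b j"
  by (simp add: chebz_def)

lemma chebz_minus: "chebz (- n) = - chebz n"
  by (simp add: chebz_def)

lemma chebz_0: "chebz 0 = 0"
  by (simp add: chebz_def)

lemma chebz_closed [simp]: "chebz n \<in> carrier H"
  using diff_closed[OF zero_closed cheb_closed] by (simp add: chebz_def)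

text \<open>At 0 both sides vanish by oddness. Negating the index keeps the letter and exchanges the
  two neighbours, so the recursion extends to negative indices.\<close>

lemma chebz_rec: "cgen H (L n) \<otimes>\<^bsub>H\<^esub> chebz n = chebz (n + 1) + chebz (n - 1)"
proof -
  have nat: "cgen H (L (int j)) \<otimes>\<^bsub>H\<^esub> chebz (int j) = chebz (int j + 1) + chebz (int j - 1)" for j
  proof (cases j)
    case 0
    then show ?thesis using chebz_minus[of 1] by (simp add: chebz_0)
  next
    case (Suc i)
    have "int j + 1 = int (Suc j)" "int j - 1 = int (j - 1)" using Suc by auto
    then show ?thesis using cheb_rec[of j] Suc by (simp only: chebz_of_nat)
  qed
  show ?thesis
  proof (cases "n \<ge> 0")
    case True
    then show ?thesis using nat[of "nat n"] by simp
  next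
    case False
    have L: "L n = L (- n)" by (rule letter_cong) simp
    have e: "n + 1 = - (- n - 1)" "n - 1 = - (- n + 1)" by simp_all
    have "cgen H (L (- n)) \<otimes>\<^bsub>H\<^esub> (0 - chebz (- n)) = 0 - (chebz (- n + 1) + chebz (- n - 1))"
      using nat[of "nat (- n)"] False by (subst mult_diff_right) auto
    then show ?thesis
      unfolding L e chebz_minus[of "- n - 1"] chebz_minus[of "- n + 1"] using chebz_minus[of "- n"] by simp
  qed
qed

text \<open>The common form of both products: \<open>y\<close> is a Chebyshev sequence of left
  factors and \<open>g\<close> obeys a matching recursion over the integers. The offset
  \<open>e\<close> fixes the parity of the acting letters, 0 for the first product and 1 for the
  second.\<close>

lemma ladder_product:
  assumes h: "h \<in> carrier H" and y: "\<And>i. y i \<in> carrier H" "y 0 = 0"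
    and y_rec: "\<And>i. y (Suc (Suc i)) = cgen H (L (k + int (Suc i) + e)) \<otimes>\<^bsub>H\<^esub> y (Suc i) - y i"
    and g: "\<And>n. g n \<in> carrier H" "\<And>n. cgen H (L (n + 1 + e)) \<otimes>\<^bsub>H\<^esub> g n = g (n + 1) + g (n - 1)"
    and start: "y 1 \<otimes>\<^bsub>H\<^esub> h = g k"
  shows "y i \<otimes>\<^bsub>H\<^esub> h = (\<Sum>r<i. g (k - int i + 1 + 2 * int r))"
proof (induction i rule: induct_nat_012)
  case 0
  show ?case using y h by simp
next
  case 1
  show ?case using start by simp
next
  case (ge2 i)
  let ?n = "\<lambda>r. k - int (Suc i) + 1 + 2 * int r"
  let ?u = "cgen H (L (k + int (Suc i) + e))"
  have u: "?u \<otimes>\<^bsub>H\<^esub> g (?n r) = g (?n r + 1) + g (?n r - 1)" for r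
  proof -
    have "L (k + int (Suc i) + e) = L (?n r + 1 + e)" by (rule letter_cong) simp
    then show ?thesis using g(2)[of "?n r"] by simp
  qed
  have "y (Suc (Suc i)) \<otimes>\<^bsub>H\<^esub> h = ?u \<otimes>\<^bsub>H\<^esub> (y (Suc i) \<otimes>\<^bsub>H\<^esub> h) - y i \<otimes>\<^bsub>H\<^esub> h"
    unfolding y_rec using y h by (simp add: H.m_assoc)
  also have "?u \<otimes>\<^bsub>H\<^esub> (y (Suc i) \<otimes>\<^bsub>H\<^esub> h) = (\<Sum>r<Suc i. g (?n r + 1)) + (\<Sum>r<Suc i. g (?n r - 1))"
    unfolding ge2 using g(1) by (subst mult_sum_right) (simp_all only: u sum.distrib cgen_L_closed)
  \<comment> \<open>The ladder shifted up contains the ladder of \<open>y i\<close>, which the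
    recursion subtracts. Its top term extends the ladder shifted down to \<open>i + 2\<close>
    terms.\<close>
  also have "(\<Sum>r<Suc i. g (?n r + 1)) = y i \<otimes>\<^bsub>H\<^esub> h + g (?n i + 1)"
    unfolding ge2 sum.lessThan_Suc by (simp add: algebra_simps)
  finally have "y (Suc (Suc i)) \<otimes>\<^bsub>H\<^esub> h = (\<Sum>r<Suc i. g (?n r - 1)) + g (?n i + 1)"
    by simp
  also have "\<dots> = (\<Sum>r<Suc (Suc i). g (k - int (Suc (Suc i)) + 1 + 2 * int r))"
    unfolding sum.lessThan_Suc[of _ "Suc i"] by (simp add: algebra_simps)
  finally show ?case .
qed

end

section \<open>Evaluation of the formal expressions and the product formulas\<close>

context dihedral_kl
begin

text \<open>Up to \<open>m\<close> the symbols are Kazhdan-Lusztig elements; beyond \<open>m\<close>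
  the replacement reproduces \<open>cheb_above\<close>. The bound \<open>2 * m\<close> covers the
  largest index \<open>i + k\<close>.\<close>

lemma eval_replaced_Csym:
  assumes "j \<le> 2 * m"
  shows "eval_replaced (\<lambda>j. c (alternating W j a b)) m (Csym j) = cheb H a b j"
proof -
  let ?C = "\<lambda>j. c (alternating W j a b)"
  have small: "eval_formal ?C (Csym l) = cheb H a b l" if "l \<le> m" for l
    using that by (simp add: eval_formal_Csym kl_eq_cheb)
  show ?thesis
  proof (cases "j \<le> m")
    case True
    then show ?thesis by (simp add: eval_replaced_def replace_pairs_Csym_le small)
  next
    case False
    define d where "d = j - m"
    have "j = m + d" "1 \<le> d" "d \<le> m" using False assms by (auto simp: d_def)
    then show ?thesis
      by (simp add: eval_replaced_def replace_pairs_Csym_above eval_formal_diff eval_formal_scal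
          small cheb_above)
  qed
qed

lemma eval_formF:
  assumes "0 < i" "i \<le> m" "0 < k" "k \<le> m"
  shows "eval_replaced (\<lambda>j. c (alternating W j a b)) m (formF i k) =
    (if i \<le> k then (\<Sum>r<i. cheb H a b (k - i + 2 * Suc r) + cheb H a b (k - i + 2 * r))
     else (\<Sum>r<k. cheb H a b (i - k + 2 * Suc r) + cheb H a b (i - k + 2 * r)))"
proof -
  have ladder: "eval_replaced (\<lambda>j. c (alternating W j a b)) m
      (Csym d + (\<Sum>r=1..<p. 2 *\<^sub>A Csym (d + 2 * r)) + Csym (d + 2 * p)) =
      (\<Sum>r<p. cheb H a b (d + 2 * Suc r) + cheb H a b (d + 2 * r))"
    if "0 < p" "d + 2 * p \<le> 2 * m" for d p
  proof -
    have "(\<Sum>r=1..<p. 2 *\<^sub>A eval_replaced (\<lambda>j. c (alternating W j a b)) m (Csym (d + 2 * r))) =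
        (\<Sum>r=1..<p. 2 *\<^sub>A cheb H a b (d + 2 * r))"
      by (rule sum.cong) (use that in \<open>auto simp: eval_replaced_Csym\<close>)
    then show ?thesis
      using that double_ladder[OF \<open>0 < p\<close>, of "\<lambda>r. cheb H a b (d + 2 * r)"]
      by (simp add: eval_replaced_add eval_replaced_sum eval_replaced_scal eval_replaced_Csym)
  qed
  consider "i < k" | "i = k" | "k < i" by linarith
  then show ?thesis
  proof cases
    case 1
    then have e: "k - i + 2 * i = k + i" "i \<le> k" by simp_all
    then have "k - i + 2 * i \<le> 2 * m" using assms by simp
    from ladder[OF assms(1) this] show ?thesis
      using 1 by (simp only: formF_def e if_True)
  next
    case 2
    \<comment> \<open>The convention for \<open>Csym 0\<close> brings the case \<open>i = k\<close>
      into the common shape with bottom index 0.\<close>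
    have "formF i k = Csym 0 + (\<Sum>r=1..<k. 2 *\<^sub>A Csym (0 + 2 * r)) + Csym (0 + 2 * k)"
      using 2 by (simp add: formF_def Csym_def)
    then show ?thesis using 2 assms ladder[of k 0] by simp
  next
    case 3
    then have e: "i - k + 2 * k = i + k" "\<not> i < k" "i \<noteq> k" "\<not> i \<le> k" by simp_all
    then have "i - k + 2 * k \<le> 2 * m" using assms by simp
    from ladder[OF assms(3) this] show ?thesis
      by (simp only: formF_def e if_False)
  qed
qed

lemma eval_formG:
  assumes "0 < i" "i \<le> m" "0 < k" "k \<le> m"
  shows "eval_replaced (\<lambda>j. c (alternating W j a b)) m (formG i k) =
    (if i \<le> k then (\<Sum>r<i. q *\<^sub>A cheb H a b (k - i + 1 + 2 * r))
     else (\<Sum>r<k. q *\<^sub>A cheb H a b (i - k + 1 + 2 * r)))"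
proof -
  have ladder: "eval_replaced (\<lambda>j. c (alternating W j a b)) m (\<Sum>r<p. q *\<^sub>A Csym (d + 1 + 2 * r)) =
      (\<Sum>r<p. q *\<^sub>A cheb H a b (d + 1 + 2 * r))" if "d + 2 * p \<le> 2 * m" for d p
    unfolding eval_replaced_sum eval_replaced_scal
    by (rule sum.cong) (use that in \<open>auto simp: eval_replaced_Csym\<close>)
  show ?thesis
  proof (cases "i \<le> k")
    case True
    then have "k - i + 2 * i \<le> 2 * m" using assms by simp
    from ladder[OF this] show ?thesis using True by (simp only: formG_def if_True)
  next
    case False
    then have "i - k + 2 * k \<le> 2 * m" using assms by simp
    from ladder[OF this] show ?thesis using False by (simp only: formG_def if_False)
  qed
qed

lemma cheb_product:
  assumes "0 < i" "i \<le> m" "0 < k" "k \<le> m"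
    and "s = (if even k then a else b)" "t = (if even k then b else a)"
  shows "cheb H s t i \<otimes>\<^bsub>H\<^esub> cheb H a b k = eval_replaced (\<lambda>j. c (alternating W j a b)) m (formF i k)"
    and "cheb H t s i \<otimes>\<^bsub>H\<^esub> cheb H a b k = eval_replaced (\<lambda>j. c (alternating W j a b)) m (formG i k)"
proof -
  interpret swap: dihedral_kl W b a m H \<iota> c by (rule swap_kl)
  have closed: "cheb H s t j \<in> carrier H" "cheb H t s j \<in> carrier H" for j
    using assms(5,6) by auto
  \<comment> \<open>The generator \<open>t\<close> is \<open>L k\<close>, which lengthens the word
    with index \<open>k\<close> when \<open>k < m\<close>, and \<open>s\<close> is its first letter.
    So the letters of both left factors are those of \<open>L\<close>, shifted by \<open>k\<close>
    or by \<open>k + 1\<close>.\<close>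
  have letters: "letter s t n = L (int k + n)" "letter t s n = L (int k + n + 1)" for n
    using assms(5,6) by (auto simp: letter_def)
  \<comment> \<open>By \<open>chebz_rec\<close> this is the product of \<open>cgen H (L n)\<close>
    with \<open>chebz n\<close>, so the first ladder starts from \<open>g k\<close>.\<close>
  define g where "g n = chebz (n + 1) + chebz (n - 1)" for n
  have g_odd: "g (- n) = - g n" "g 0 = 0" for n
  proof -
    have "- n + 1 = - (n - 1)" "- n - 1 = - (n + 1)" by simp_all
    then show "g (- n) = - g n" by (simp only: g_def chebz_minus) simp
    show "g 0 = 0" using chebz_minus[of 1] by (simp add: g_def)
  qed
  have g_nat: "g (int d + 1 + 2 * int r) = cheb H a b (d + 2 * Suc r) + cheb H a b (d + 2 * r)" for d r
  proof -
    have "int d + 1 + 2 * int r + 1 = int (d + 2 * Suc r)" "int d + 1 + 2 * int r - 1 = int (d + 2 * r)"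
      by simp_all
    then show ?thesis by (simp only: g_def chebz_of_nat)
  qed
  have "cheb H s t i \<otimes>\<^bsub>H\<^esub> cheb H a b k = (\<Sum>r<i. g (int k - int i + 1 + 2 * int r))"
  proof (rule ladder_product[where e = 0])
    fix n
    \<comment> \<open>The two terms of \<open>g n\<close> have indices of equal parity, so a single
      letter acts on both by \<open>chebz_rec\<close>.\<close>
    have L: "L (n + 1 + 0) = L (n + 1)" "L (n + 1) = L (n - 1)" by (rule letter_cong, simp)+
    show "cgen H (L (n + 1 + 0)) \<otimes>\<^bsub>H\<^esub> g n = g (n + 1) + g (n - 1)"
      using chebz_rec[of "n + 1"] chebz_rec[of "n - 1"] unfolding L(1)
      by (simp add: g_def L(2))
  next
    have "cheb H s t 1 = cgen H (L (int k))"
      using letters(1)[of 0] by (simp add: letter_def)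
    then show "cheb H s t 1 \<otimes>\<^bsub>H\<^esub> cheb H a b k = g (int k)"
      using chebz_rec[of "int k"] by (simp add: g_def chebz_of_nat)
  qed (simp_all add: closed letters g_def)
  also have "\<dots> = (if i \<le> k then (\<Sum>r<i. g (int (k - i) + 1 + 2 * int r))
      else (\<Sum>r<k. g (int (i - k) + 1 + 2 * int r)))"
    using ladder_swap[of g k i, OF g_odd] by (simp add: of_nat_diff)
  finally show "cheb H s t i \<otimes>\<^bsub>H\<^esub> cheb H a b k =
      eval_replaced (\<lambda>j. c (alternating W j a b)) m (formF i k)"
    unfolding eval_formF[OF assms(1-4)] by (simp only: g_nat)
  \<comment> \<open>The last factor of the second word is \<open>s\<close>, the first letter of the
    word with index \<open>k\<close>; by \<open>cheb_descent\<close> it contributes the scalar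
    \<open>q\<close>, which all ladder terms inherit.\<close>
  define g' where "g' n = q *\<^sub>A chebz n" for n
  have g'_odd: "g' (- n) = - g' n" "g' 0 = 0" for n
    by (simp_all add: g'_def chebz_minus chebz_0)
  have g'_nat: "g' (int d + 1 + 2 * int r) = q *\<^sub>A cheb H a b (d + 1 + 2 * r)" for d r
  proof -
    have "int d + 1 + 2 * int r = int (d + 1 + 2 * r)" by simp
    then show ?thesis by (simp only: g'_def chebz_of_nat)
  qed
  have "cheb H t s i \<otimes>\<^bsub>H\<^esub> cheb H a b k = (\<Sum>r<i. g' (int k - int i + 1 + 2 * int r))"
  proof (rule ladder_product[where e = 1])
    fix n
    have L: "L (n + 1 + 1) = L n" by (rule letter_cong) simp
    show "cgen H (L (n + 1 + 1)) \<otimes>\<^bsub>H\<^esub> g' n = g' (n + 1) + g' (n - 1)"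
      using chebz_rec[of n] unfolding L by (simp add: g'_def scal.scale_right_distrib)
  next
    have "L (int k + 0 + 1) = L (int k - 1)" by (rule letter_cong) simp
    then have "cheb H t s 1 = cgen H (L (int k - 1))"
      using letters(2)[of 0] by (simp add: letter_def)
    then show "cheb H t s 1 \<otimes>\<^bsub>H\<^esub> cheb H a b k = g' (int k)"
      using cheb_descent[of k] by (simp add: g'_def chebz_of_nat)
  qed (simp_all add: closed letters g'_def)
  also have "\<dots> = (if i \<le> k then (\<Sum>r<i. g' (int (k - i) + 1 + 2 * int r))
      else (\<Sum>r<k. g' (int (i - k) + 1 + 2 * int r)))"
    using ladder_swap[of g' k i, OF g'_odd] by (simp add: of_nat_diff)
  finally show "cheb H t s i \<otimes>\<^bsub>H\<^esub> cheb H a b k =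
      eval_replaced (\<lambda>j. c (alternating W j a b)) m (formG i k)"
    unfolding eval_formG[OF assms(1-4)] by (simp only: g'_nat)
qed

end

theorem proposition4p6:
  fixes W :: "('a, 'e) monoid_scheme" and s1 s2 a b s t :: 'a and m i k :: nat
    and H :: "('a hecke) ring" and \<iota> :: "'a hecke \<Rightarrow> 'a hecke" and c :: "'a \<Rightarrow> 'a hecke"
  assumes "m \<ge> 2"
    and "dihedral_group W s1 s2 m"
    and "hecke_algebra W {s1, s2} H"
    and "hecke_involution W H \<iota>"
    and "kl_basis W {s1, s2} \<iota> c"
    and "(a, b) = (s1, s2) \<or> (a, b) = (s2, s1)"
    and "0 < k" "k \<le> m"
    and "s = (if even k then a else b)"
    and "t = (if even k then b else a)"
    and "0 < i" "i \<le> m"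
  shows "c (alternating W i s t) \<otimes>\<^bsub>H\<^esub> c (alternating W k a b) =
           eval_formal (\<lambda>j. c (alternating W j a b)) (replace_pairs m (formF i k)) \<and>
         c (alternating W i t s) \<otimes>\<^bsub>H\<^esub> c (alternating W k a b) =
           eval_formal (\<lambda>j. c (alternating W j a b)) (replace_pairs m (formG i k))"
proof -
  have "group W" using assms(2) by (simp add: dihedral_group_def)
  then have "dihedral_kl W s1 s2 m H \<iota> c"
    using assms(1-5)
    by (simp add: dihedral_kl_def dihedral_kl_axioms_def dihedral_hecke_def dihedral_def
        dihedral_axioms_def)
  then have "dihedral_kl W a b m H \<iota> c"
    using assms(6) dihedral_kl.swap_kl[of W s1 s2] by auto
  then interpret dihedral_kl W a b m H \<iota> c .
  interpret swap: dihedral_kl W b a m H \<iota> c by (rule swap_kl)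
  \<comment> \<open>The pair \<open>(s, t)\<close> is \<open>(a, b)\<close> or \<open>(b, a)\<close>
    according to the parity of \<open>k\<close>, so the identification is needed in both
    orders.\<close>
  have "c (alternating W i s t) = cheb H s t i" "c (alternating W i t s) = cheb H t s i"
    "c (alternating W k a b) = cheb H a b k"
    using kl_eq_cheb swap.kl_eq_cheb assms by auto
  then show ?thesis
    using cheb_product[of i k s t] assms by (simp add: eval_replaced_def)
qed

end
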